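(* Let $\lambda\in(0,1)$. The Poisson distribution of parameter $\lambda$, $\Pr(X=r)=e^{-\lambda}\lambda^r/r!$ ($r\ge 0$), and the logarithmic distribution of parameter $\lambda$, $\Pr(X=r)=\frac{1}{L}\frac{\lambda^r}{r}$ ($r\ge 1$, $L:=\log(1-\lambda)^{-1}$), have a strong simulation by a Buffon machine, namely the von Neumann machines $\Gamma\mathrm{VN}[\mathcal R](\lambda)$ and $\Gamma\mathrm{VN}[\mathcal S](\lambda)$, respectively, each of which only uses a single string register. Here $\mathcal R$ is the class of sorted permutations (one of each size $n\ge 0$) and $\mathcal S$ is the class of permutations of size $n\ge1$ whose maximum occurs in the first position.
   Context: A Buffon machine is a deterministic device belonging to a computationally universal class (Turing machines or, equivalently, register machines), equipped with an external source of independent uniform random bits (each call to this source is a ``flip'') and with input--output queues capable of storing integers, and which is assumed to halt with probability $1$. A Bernoulli generator $\Gamma\mathrm{B}(\lambda)$ is an external routine each call to which returns a fresh independent $\{0,1\}$-valued random variable equal to $1$ with probability $\lambda$; the value of $\lambda$ need not be known to the machine calling it. A geometric generator $\Gamma\mathrm{G}(\lambda)$ returns $N$ with $\Pr(N=r)=\lambda^r(1-\lambda)$, $r\ge0$; it is obtained from $\Gamma\mathrm{B}(\lambda)$ by counting the number of $1$s before the first $0$. A machine that has access to $\Gamma\mathrm{B}(\lambda)$ (on its input) simulates a distribution if, with probability $1$, it halts and its output has exactly that distribution. The simulation is strong if the random number $C\equiv C(\lambda)$ of coin flips has exponential tails, i.e., there are constants $K$ and $\rho<1$ such that $\Pr(C>m)\le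 K\rho^m$ for all $m$. The von Neumann schema $\Gamma\mathrm{VN}[\mathcal P](\lambda)$, for a class $\mathcal P$ of permutations with $\mathcal P_n$ its set of elements of size $n$, repeats the following trial until success: draw $N:=\Gamma\mathrm{G}(\lambda)$; let $\mathbf U=(U_1,\dots,U_N)$ be a vector of independent uniform $[0,1]$ variables, whose binary digits are produced by flips only when needed in order to determine the order type of $\mathbf U$ (the permutation $\sigma$ of $\{1,\dots,N\}$ obtained by replacing each $U_j$ by its rank in $\mathbf U$) to the extent required to test whether $\sigma\in\mathcal P_N$; if $\sigma\in\mathcal P_N$, return $N$. For $\mathcal R$ the test is $U_1<U_2<\cdots<U_N$, and for $\mathcal S$ it is $N\ge1$ and $U_1>U_2,\dots,U_N$. A string register is a register storing a finite string of bits (here, a partial binary expansion of a $U_j$). *)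

theory Defs
  imports "HOL-Probability.Probability"
begin

section \<open>Buffon machines\<close>

text \<open>
  The universal class of devices is that of register machines over \<^emph>\<open>integer registers\<close>
  (natural numbers; \<open>Inc\<close> and \<open>Dec\<close> alone already give a universal counter machine), extended by
  \<^emph>\<open>string registers\<close> (finite bit strings) and by input and output queues of integers.
  Randomness comes only from \<open>Flip\<close> (one fair bit) and \<open>Gen\<close> (one call to the Bernoulli
  generator). A program is a list of instructions. In all instructions the last arguments are jump
  targets; control passes to the following instruction unless a jump is taken.
\<close>

datatype instr =
    Inc nat                  \<comment> \<open>\<open>Inc r\<close>: add 1 to integer register \<open>r\<close>\<close>
  | Dec nat nat              \<comment> \<open>\<open>Dec r l\<close>: jump to \<open>l\<close> if register \<open>r\<close> is 0, else subtract 1 from it\<close>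
  | Jump nat
  | Read nat nat             \<comment> \<open>\<open>Read r l\<close>: jump to \<open>l\<close> if the input queue is empty, else dequeue into \<open>r\<close>\<close>
  | Write nat                \<comment> \<open>\<open>Write r\<close>: enqueue the content of \<open>r\<close> on the output queue\<close>
  | Append nat bool          \<comment> \<open>\<open>Append s b\<close>: append bit \<open>b\<close> to string register \<open>s\<close>\<close>
  | Truncate nat nat         \<comment> \<open>\<open>Truncate s r\<close>: keep the first \<open>R\<^sub>r\<close> bits of string register \<open>s\<close>\<close>
  | Branch nat nat nat nat   \<comment> \<open>\<open>Branch s r l l'\<close>: jump to \<open>l'\<close> if string \<open>s\<close> has no bit at position \<open>R\<^sub>r\<close>
                                  (counted from 0), to \<open>l\<close> if that bit is 1\<close>
  | Flip nat                 \<comment> \<open>\<open>Flip l\<close>: draw a fair bit, jump to \<open>l\<close> if it is 1\<close>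
  | Gen nat                  \<comment> \<open>\<open>Gen l\<close>: call the Bernoulli generator, jump to \<open>l\<close> if it returns 1\<close>

type_synonym machine = "instr list"

record config =
  pc     :: nat
  ints   :: "nat \<Rightarrow> nat"
  strs   :: "nat \<Rightarrow> bool list"
  inq    :: "nat list"
  outq   :: "nat list"
  nflips :: nat
  ngens  :: nat

text \<open>
  A machine is deterministic once its two sources are given: \<open>f\<close> is the sequence of answers to the
  successive flips, \<open>g\<close> the sequence of answers of the Bernoulli generator. The components
  \<open>nflips\<close> and \<open>ngens\<close> count the answers used so far.
\<close>

fun exec :: "bool stream \<times> bool stream \<Rightarrow> instr \<Rightarrow> config \<Rightarrow> config" where
  "exec \<omega> (Inc r) c = c\<lparr>pc := Suc (pc c), ints := (ints c)(r := Suc (ints c r))\<rparr>"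
| "exec \<omega> (Dec r l) c =
    (if ints c r = 0 then c\<lparr>pc := l\<rparr>
     else c\<lparr>pc := Suc (pc c), ints := (ints c)(r := ints c r - 1)\<rparr>)"
| "exec \<omega> (Jump l) c = c\<lparr>pc := l\<rparr>"
| "exec \<omega> (Read r l) c =
    (case inq c of [] \<Rightarrow> c\<lparr>pc := l\<rparr>
     | x # xs \<Rightarrow> c\<lparr>pc := Suc (pc c), ints := (ints c)(r := x), inq := xs\<rparr>)"
| "exec \<omega> (Write r) c = c\<lparr>pc := Suc (pc c), outq := outq c @ [ints c r]\<rparr>"
| "exec \<omega> (Append s b) c = c\<lparr>pc := Suc (pc c), strs := (strs c)(s := strs c s @ [b])\<rparr>"
| "exec \<omega> (Truncate s r) c =
    c\<lparr>pc := Suc (pc c), strs := (strs c)(s := take (ints c r) (strs c s))\<rparr>"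
| "exec \<omega> (Branch s r l l') c =
    c\<lparr>pc := (if ints c r \<ge> length (strs c s) then l'
             else if strs c s ! ints c r then l else Suc (pc c))\<rparr>"
| "exec \<omega> (Flip l) c =
    c\<lparr>pc := (if fst \<omega> !! nflips c then l else Suc (pc c)), nflips := Suc (nflips c)\<rparr>"
| "exec \<omega> (Gen l) c =
    c\<lparr>pc := (if snd \<omega> !! ngens c then l else Suc (pc c)), ngens := Suc (ngens c)\<rparr>"

definition halted :: "machine \<Rightarrow> config \<Rightarrow> bool" where
  "halted M c \<longleftrightarrow> pc c \<ge> length M"

definition step :: "machine \<Rightarrow> bool stream \<times> bool stream \<Rightarrow> config \<Rightarrow> config" where
  "step M \<omega> c = (if halted M c then c else exec \<omega> (M ! pc c) c)"

definition init :: config where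
  "init = \<lparr>pc = 0, ints = (\<lambda>_. 0), strs = (\<lambda>_. []), inq = [], outq = [], nflips = 0, ngens = 0\<rparr>"

definition run :: "machine \<Rightarrow> bool stream \<times> bool stream \<Rightarrow> nat \<Rightarrow> config" where
  "run M \<omega> n = (step M \<omega> ^^ n) init"

definition halts :: "machine \<Rightarrow> bool stream \<times> bool stream \<Rightarrow> bool" where
  "halts M \<omega> \<longleftrightarrow> (\<exists>n. halted M (run M \<omega> n))"

definition result :: "machine \<Rightarrow> bool stream \<times> bool stream \<Rightarrow> nat list" where
  "result M \<omega> = (if halts M \<omega> then outq (run M \<omega> (LEAST n. halted M (run M \<omega> n))) else [])"

text \<open>The number \<open>C\<close> of coin flips; it may be infinite if the machine does not halt.\<close>

definition total_flips :: "machine \<Rightarrow> bool stream \<times> bool stream \<Rightarrow> enat" where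
  "total_flips M \<omega> = (SUP n. enat (nflips (run M \<omega> n)))"

primrec string_regs_instr :: "instr \<Rightarrow> nat set" where
  "string_regs_instr (Inc r) = {}"
| "string_regs_instr (Dec r l) = {}"
| "string_regs_instr (Jump l) = {}"
| "string_regs_instr (Read r l) = {}"
| "string_regs_instr (Write r) = {}"
| "string_regs_instr (Append s b) = {s}"
| "string_regs_instr (Truncate s r) = {s}"
| "string_regs_instr (Branch s r l l') = {s}"
| "string_regs_instr (Flip l) = {}"
| "string_regs_instr (Gen l) = {}"

definition string_regs :: "machine \<Rightarrow> nat set" where
  "string_regs M = (\<Union>i\<in>set M. string_regs_instr i)"


section \<open>Simulation and strong simulation\<close>

text \<open>Fair independent flips, and, independently of them, calls to the generator \<open>\<Gamma>B(lam)\<close>.\<close>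

definition source :: "real \<Rightarrow> (bool stream \<times> bool stream) measure" where
  "source lam = stream_space (measure_pmf (bernoulli_pmf (1/2)))
               \<Otimes>\<^sub>M stream_space (measure_pmf (bernoulli_pmf lam))"

definition buffon_machine :: "machine \<Rightarrow> real \<Rightarrow> bool" where
  "buffon_machine M lam \<longleftrightarrow> (AE \<omega> in source lam. halts M \<omega>)"

text \<open>The output queue finally contains exactly one integer, which has distribution \<open>p\<close>.\<close>

definition simulates :: "machine \<Rightarrow> real \<Rightarrow> nat pmf \<Rightarrow> bool" where
  "simulates M lam p \<longleftrightarrow>
     buffon_machine M lam \<and>
     result M \<in> source lam \<rightarrow>\<^sub>M count_space UNIV \<and>
     distr (source lam) (count_space UNIV) (result M) = measure_pmf (map_pmf (\<lambda>r. [r]) p)"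

definition exponential_tails :: "'a measure \<Rightarrow> ('a \<Rightarrow> enat) \<Rightarrow> bool" where
  "exponential_tails \<mu> C \<longleftrightarrow>
     C \<in> \<mu> \<rightarrow>\<^sub>M count_space UNIV \<and>
     (\<exists>K \<rho>::real. 0 \<le> \<rho> \<and> \<rho> < 1 \<and>
        (\<forall>m::nat. measure \<mu> {\<omega> \<in> space \<mu>. C \<omega> > enat m} \<le> K * \<rho> ^ m))"

definition strongly_simulates :: "machine \<Rightarrow> real \<Rightarrow> nat pmf \<Rightarrow> bool" where
  "strongly_simulates M lam p \<longleftrightarrow>
     simulates M lam p \<and> exponential_tails (source lam) (total_flips M)"


section \<open>The von Neumann schema\<close>

text \<open>Permutations of \<open>{1..n}\<close> are words \<open>\<sigma>\<^sub>1\<dots>\<sigma>\<^sub>n\<close> in one-line notation; the size is the length.\<close>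

definition permutation_words :: "nat list set" where
  "permutation_words = {\<sigma>. distinct \<sigma> \<and> set \<sigma> = {1..length \<sigma>}}"

definition sorted_perms :: "nat list set" where
  "sorted_perms = {\<sigma> \<in> permutation_words. sorted \<sigma>}"

definition max_first_perms :: "nat list set" where
  "max_first_perms = {\<sigma> \<in> permutation_words. length \<sigma> \<ge> 1 \<and> hd \<sigma> = Max (set \<sigma>)}"

text \<open>Each entry is replaced by its rank.\<close>

definition order_type :: "real list \<Rightarrow> nat list" where
  "order_type u = map (\<lambda>x. card {y \<in> set u. y \<le> x}) u"

text \<open>The reals in \<open>[0,1)\<close> whose binary expansion starts with \<open>w\<close>.\<close>

definition cylinder :: "bool list \<Rightarrow> real set" where
  "cylinder w = (let a = \<Sum>i<length w. of_bool (w ! i) / 2 ^ Suc i in {a ..< a + 1 / 2 ^ length w})"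

text \<open>
  The vectors \<open>(U\<^sub>1,\<dots>,U\<^sub>N)\<close> compatible with the digits known so far, \<open>ws ! j\<close> being the known
  partial expansion of the \<open>j\<close>-th coordinate. Ties have probability 0 and are left out.
\<close>

definition compatible :: "bool list list \<Rightarrow> real list set" where
  "compatible ws =
     {u. length u = length ws \<and> distinct u \<and> (\<forall>j<length ws. u ! j \<in> cylinder (ws ! j))}"

definition decided :: "nat list set \<Rightarrow> bool list list \<Rightarrow> bool" where
  "decided P ws \<longleftrightarrow>
     (\<forall>u\<in>compatible ws. \<forall>v\<in>compatible ws. order_type u \<in> P \<longleftrightarrow> order_type v \<in> P)"

definition verdict :: "nat list set \<Rightarrow> bool list list \<Rightarrow> bool" where
  "verdict P ws \<longleftrightarrow> (\<exists>u\<in>compatible ws. order_type u \<in> P)"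

text \<open>
  Further digits of the \<open>j\<close>-th coordinate are needed if, for some values of the other coordinates,
  the outcome of the test still depends on them.
\<close>

definition needed :: "nat list set \<Rightarrow> bool list list \<Rightarrow> nat \<Rightarrow> bool" where
  "needed P ws j \<longleftrightarrow>
     (\<exists>u\<in>compatible ws. \<exists>v\<in>compatible ws.
        (\<forall>i<length ws. i \<noteq> j \<longrightarrow> u ! i = v ! i) \<and> order_type u \<in> P \<and> order_type v \<notin> P)"

text \<open>
  The schema leaves open in which order the digits are produced. A query rule \<open>q\<close> tells, from
  the digits known so far, which coordinate receives the next flip; it is lazy if it only ever asks
  for digits that are needed.
\<close>

inductive reachable :: "nat list set \<Rightarrow> (bool list list \<Rightarrow> nat) \<Rightarrow> nat \<Rightarrow> bool list list \<Rightarrow> bool"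
  for P q N where
  "reachable P q N (replicate N [])"
| "reachable P q N ws \<Longrightarrow> \<not> decided P ws \<Longrightarrow> reachable P q N (ws[q ws := ws ! q ws @ [b]])"

definition lazy_rule :: "nat list set \<Rightarrow> (bool list list \<Rightarrow> nat) \<Rightarrow> bool" where
  "lazy_rule P q \<longleftrightarrow> (\<forall>N ws. reachable P q N ws \<longrightarrow> \<not> decided P ws \<longrightarrow> needed P ws (q ws))"

text \<open>\<open>VN_test P q ws fl v\<close>: from the known digits \<open>ws\<close>, the test consumes exactly the flips \<open>fl\<close>
  and has outcome \<open>v\<close>.\<close>

inductive VN_test ::
    "nat list set \<Rightarrow> (bool list list \<Rightarrow> nat) \<Rightarrow> bool list list \<Rightarrow> bool list \<Rightarrow> bool \<Rightarrow> bool"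
  for P q where
  "decided P ws \<Longrightarrow> VN_test P q ws [] (verdict P ws)"
| "\<not> decided P ws \<Longrightarrow> VN_test P q (ws[q ws := ws ! q ws @ [b]]) fl v \<Longrightarrow> VN_test P q ws (b # fl) v"

text \<open>
  \<open>VN_run P q fl gl N\<close>: the schema returns \<open>N\<close> after consuming exactly the flips \<open>fl\<close> and the
  generator answers \<open>gl\<close>. A call to \<open>\<Gamma>G(lam)\<close> consumes a run of 1s and the first 0, and
  returns the number of 1s.
\<close>

inductive VN_run ::
    "nat list set \<Rightarrow> (bool list list \<Rightarrow> nat) \<Rightarrow> bool list \<Rightarrow> bool list \<Rightarrow> nat \<Rightarrow> bool"
  for P q where
  "VN_test P q (replicate N []) fl True \<Longrightarrow> VN_run P q fl (replicate N True @ [False]) N"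
| "VN_test P q (replicate N []) fl False \<Longrightarrow> VN_run P q fl' gl' r \<Longrightarrow>
     VN_run P q (fl @ fl') (replicate N True @ [False] @ gl') r"

text \<open>
  A machine implements \<open>\<Gamma>VN[P]\<close> if, on all sources, it halts exactly when the schema terminates,
  with the same output and the same consumption of flips and of generator calls.
\<close>

definition implements_VN :: "machine \<Rightarrow> nat list set \<Rightarrow> bool" where
  "implements_VN M P \<longleftrightarrow>
     (\<exists>q. lazy_rule P q \<and>
        (\<forall>f g out nf ng.
           (\<exists>n. halted M (run M (f, g) n) \<and> outq (run M (f, g) n) = out \<and>
                nflips (run M (f, g) n) = nf \<and> ngens (run M (f, g) n) = ng) \<longleftrightarrow>
           (\<exists>N. out = [N] \<and> VN_run P q (stake nf f) (stake ng g) N)))"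


section \<open>The two von Neumann machines\<close>

text \<open>
  Integer register 0 holds \<open>N\<close>, register 1 the number of comparisons still to be made, register 2 the
  current position \<open>i\<close>. For \<open>VN_sorted\<close>, string register 0 holds the known digits of the
  last \<open>U\<^sub>j\<close> so far, to be compared with \<open>U\<^bsub>j+1\<^esub>\<close>; once \<open>U\<^sub>j < U\<^bsub>j+1\<^esub>\<close> is established at
  position \<open>i\<close>, the first \<open>i\<close> digits of both agree and the register is overwritten by those of
  \<open>U\<^bsub>j+1\<^esub>\<close>. For \<open>VN_max_first\<close>, it holds the known digits of \<open>U\<^sub>1\<close>.
\<close>

definition VN_sorted :: machine where
  "VN_sorted =
    [ \<comment> \<open>0: start of a trial, clear registers 0 and 1\<close>
      Dec 0 2, Jump 0, Dec 1 4, Jump 2,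
      \<comment> \<open>4: geometric generator\<close>
      Gen 6, Jump 9, Inc 0, Inc 1, Jump 4,
      \<comment> \<open>9: accept if \<open>N = 0\<close>; otherwise \<open>N - 1\<close> comparisons, starting with no digits\<close>
      Dec 1 31, Dec 2 12, Jump 10, Truncate 0 2,
      \<comment> \<open>13: next comparison, accept if there is none left\<close>
      Dec 1 31, Dec 2 16, Jump 14,
      \<comment> \<open>16: compare digits at position \<open>i\<close>, the second one being a fresh flip\<close>
      Branch 0 2 19 23,
      Flip 28, Jump 21,
      Flip 21, Jump 0,
      \<comment> \<open>21: equal digits\<close>
      Inc 2, Jump 16,
      \<comment> \<open>23: a fresh digit for the stored expansion\<close>
      Flip 26, Append 0 False, Jump 16, Append 0 True, Jump 16,
      \<comment> \<open>28: store the digits of the greater number\<close>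
      Truncate 0 2, Append 0 True, Jump 13,
      \<comment> \<open>31: accept\<close>
      Write 0 ]"

definition VN_max_first :: machine where
  "VN_max_first =
    [ \<comment> \<open>0: start of a trial, clear registers 0 and 1\<close>
      Dec 0 2, Jump 0, Dec 1 4, Jump 2,
      \<comment> \<open>4: geometric generator\<close>
      Gen 6, Jump 9, Inc 0, Inc 1, Jump 4,
      \<comment> \<open>9: reject if \<open>N = 0\<close>; otherwise \<open>N - 1\<close> comparisons, starting with no digits\<close>
      Dec 1 0, Dec 2 12, Jump 10, Truncate 0 2,
      \<comment> \<open>13: next comparison, accept if there is none left\<close>
      Dec 1 28, Dec 2 16, Jump 14,
      \<comment> \<open>16: compare digits at position \<open>i\<close>, the second one being a fresh flip\<close>
      Branch 0 2 19 23,
      Flip 0, Jump 21,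
      Flip 21, Jump 13,
      \<comment> \<open>21: equal digits\<close>
      Inc 2, Jump 16,
      \<comment> \<open>23: a fresh digit for the stored expansion\<close>
      Flip 26, Append 0 False, Jump 16, Append 0 True, Jump 16,
      \<comment> \<open>28: accept\<close>
      Write 0 ]"


section \<open>The logarithmic distribution\<close>

text \<open>The Poisson distribution is \<open>poisson_pmf\<close> of the library, see \<open>pmf_poisson\<close>.\<close>

definition logarithmic_pmf :: "real \<Rightarrow> nat pmf" where
  "logarithmic_pmf lam =
     embed_pmf (\<lambda>r. if r \<ge> 1 then 1 / ln (1 / (1 - lam)) * (lam ^ r / real r) else 0)"

lemma pmf_logarithmic:
  assumes "0 < lam" "lam < 1"
  shows "pmf (logarithmic_pmf lam) r =
           (if r \<ge> 1 then 1 / ln (1 / (1 - lam)) * (lam ^ r / real r) else 0)"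
proof -
  define L where "L = ln (1 / (1 - lam))"
  have L: "L > 0" unfolding L_def using assms by (intro ln_gt_zero) (simp add: field_simps)
  define h where "h = (\<lambda>r::nat. if r \<ge> 1 then 1 / L * (lam ^ r / real r) else 0)"
  have nn: "0 \<le> h r" for r using L assms by (simp add: h_def)
  have "(\<lambda>n. - ((- (- lam)) ^ n) / of_nat n) sums ln (1 + (- lam))"
    by (rule ln_series') (use assms in auto)
  hence "(\<lambda>n. - (- (lam ^ n) / real n)) sums - ln (1 - lam)"
    by (intro sums_minus) simp
  moreover have "- ln (1 - lam) = L" unfolding L_def using assms by (simp add: ln_div)
  ultimately have "(\<lambda>n. lam ^ n / real n) sums L" by simp
  hence "(\<lambda>n. 1 / L * (lam ^ n / real n)) sums (1 / L * L)" by (intro sums_mult)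
  moreover have "(\<lambda>n. 1 / L * (lam ^ n / real n)) = h" by (auto simp: fun_eq_iff h_def)
  ultimately have s: "h sums 1" using L by simp
  have "(\<integral>\<^sup>+ r. ennreal (h r) \<partial>count_space UNIV) = (\<Sum>r. ennreal (h r))"
    by (simp add: nn_integral_count_space_nat)
  also have "\<dots> = ennreal (\<Sum>r. h r)"
    using nn s by (intro suminf_ennreal2) (auto simp: sums_iff)
  also have "\<dots> = 1" using s by (simp add: sums_iff)
  finally have "(\<integral>\<^sup>+ r. ennreal (h r) \<partial>count_space UNIV) = 1" .
  hence "pmf (embed_pmf h) r = h r" using nn by (intro pmf_embed_pmf)
  thus ?thesis unfolding logarithmic_pmf_def h_def L_def .
qed

end

theory Submission
  imports Defs "HOL-Library.Sublist"
begin

text \<open>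
  Both machines draw \<open>N\<close> geometrically and then test the order type of \<open>N\<close> lazily revealed
  uniform numbers by \<open>N - 1\<close> successive comparisons: a \<^emph>\<open>newcomer\<close> \<open>U\<^sub>j\<close> is compared with a
  \<^emph>\<open>champion\<close>, which is the predecessor \<open>U\<^bsub>j-1\<^esub>\<close> for sorted permutations and \<open>U\<^sub>1\<close> for
  permutations that start with their maximum. Digits of a newcomer are drawn only until it
  differs from the champion, and further digits of the champion only when all its known ones
  agree with those of the newcomer. One string register is therefore enough: it holds the digits
  of the champion, and the known digits of the newcomer are a prefix of them, up to the last
  digit if that one decides the comparison.

  This behaviour is captured by a small chain of decisions, \<open>nxt\<close>, whose states sit at the
  points where a random bit is requested. Everything is deduced from that chain.

  \<^item> The programs follow the chain (\<open>machine_path\<close>): between two requests a program only does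
    finitely many deterministic steps.
  \<^item> The schema follows the chain too (\<open>VN_run_iff_path\<close>). The known digits \<open>ws\<close> determine the
    state (\<open>matches\<close>), and in a comparison state both outcomes of the test can still be reached
    by changing only the coordinate that is asked for (\<open>matches_Cmp_needed\<close>). Hence the query
    rule is lazy and the test is decided exactly when the chain leaves its comparison states.
  \<^item> The number of requests has exponential tails (\<open>alive_exponential\<close>). A comparison takes a
    geometrically distributed number of rounds of at most two flips, so it multiplies an
    exponential moment with rate \<open>t\<close> by at most \<open>c(t)\<close>, where \<open>c(t)\<close> tends to 1 as \<open>t\<close> tends to
    1. A trial with \<open>N = 1\<close> succeeds outright, and this alone makes the expected multiplier of a
    whole trial less than 1 for \<open>t\<close> close to 1. Almost sure termination is a consequence.
  \<^item> The success probability of a trial with \<open>N = n\<close> is \<open>1 / n!\<close> or \<open>1 / n\<close>. The proof does not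
    integrate over \<open>n\<close> dimensions: from each comparison state the success probability is an
    explicit integral of a polynomial over a dyadic interval (\<open>win\<close>), and splitting the interval
    of the number whose digit is drawn shows that it is the average over the two successors
    (\<open>win_extend\<close>, \<open>win_compare\<close>). A bounded function on the states that is harmonic for the
    chain and is the indicator of \<open>r\<close> on returned values gives the probability of the output \<open>r\<close>
    (\<open>prob_result\<close>). Rejection sampling then yields \<open>\<lambda>\<^sup>r / r!\<close> and \<open>\<lambda>\<^sup>r / r\<close> up to
    normalization.
\<close>

section \<open>The chain of random decisions\<close>

datatype kind = Sorted | MaxFirst

fun perms :: "kind \<Rightarrow> nat list set" where
  "perms Sorted = sorted_perms"
| "perms MaxFirst = max_first_perms"

fun prog :: "kind \<Rightarrow> machine" where
  "prog Sorted = VN_sorted"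
| "prog MaxFirst = VN_max_first"

text \<open>
  A state is a point at which a random bit is requested, or the end of the run. \<open>Geo n\<close>: the
  geometric generator has counted \<open>n\<close> ones. \<open>Cmp n v r k\<close>: a trial with \<open>N = n\<close> is in the middle
  of a comparison; the champion has the known digits \<open>v @ r\<close>, the newcomer has the known digits
  \<open>v\<close>, and \<open>k\<close> comparisons follow the current one. Splitting the stored string at the current
  position makes every term of this form a legitimate state, without an invariant.
\<close>

datatype state =
    Geo nat
  | Cmp nat "bool list" "bool list" nat
  | Ret nat

text \<open>
  The champion has known digits \<open>w\<close>, and \<open>k\<close> comparisons remain.
\<close>

definition pass :: "nat \<Rightarrow> bool list \<Rightarrow> nat \<Rightarrow> state" where
  "pass n w k = (case k of 0 \<Rightarrow> Ret n | Suc k' \<Rightarrow> Cmp n [] w k')"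

text \<open>
  The result of the geometric generator is \<open>n\<close>. For \<open>n = 0\<close> the empty permutation is sorted, but
  it has no first entry; a rejection is a return to \<open>Geo 0\<close>.
\<close>

definition trial :: "kind \<Rightarrow> nat \<Rightarrow> state" where
  "trial K n = (if n = 0 then (if K = Sorted then Ret 0 else Geo 0) else pass n [] (n - 1))"

text \<open>
  The newcomer shows \<open>b\<close> where the champion shows the opposite bit, after the common prefix \<open>v\<close>.
  For \<open>Sorted\<close> a greater newcomer becomes the champion, with digits \<open>v @ [True]\<close>; for \<open>MaxFirst\<close>
  a smaller newcomer leaves the champion in place.
\<close>

fun differ :: "kind \<Rightarrow> bool \<Rightarrow> nat \<Rightarrow> bool list \<Rightarrow> bool list \<Rightarrow> nat \<Rightarrow> state" where
  "differ Sorted b n v r k = (if b then pass n (v @ [True]) k else Geo 0)"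
| "differ MaxFirst b n v r k = (if b then Geo 0 else pass n (v @ True # r) k)"

fun nxt :: "kind \<Rightarrow> state \<Rightarrow> bool \<Rightarrow> state" where
  "nxt K (Geo n) b = (if b then Geo (Suc n) else trial K n)"
| "nxt K (Cmp n v [] k) b = Cmp n v [b] k"
| "nxt K (Cmp n v (x # r) k) b = (if b = x then Cmp n (v @ [x]) r k else differ K b n v r k)"
| "nxt K (Ret n) b = Ret n"

text \<open>
  The words of consumed flips and generator answers are kept apart, as in \<open>VN_run\<close>.
\<close>

inductive path :: "kind \<Rightarrow> state \<Rightarrow> bool list \<Rightarrow> bool list \<Rightarrow> state \<Rightarrow> bool" for K where
  path_refl: "path K s [] [] s"
| path_gen: "path K (nxt K (Geo n) b) fl gl s \<Longrightarrow> path K (Geo n) fl (b # gl) s"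
| path_flip: "path K (nxt K (Cmp n v r k) b) fl gl s \<Longrightarrow> path K (Cmp n v r k) (b # fl) gl s"

primrec chain :: "kind \<Rightarrow> nat \<Rightarrow> state \<Rightarrow> bool stream \<times> bool stream \<Rightarrow> state" where
  "chain K 0 s \<omega> = s"
| "chain K (Suc m) s \<omega> =
     (case s of
        Geo n \<Rightarrow> chain K m (nxt K s (shd (snd \<omega>))) (fst \<omega>, stl (snd \<omega>))
      | Cmp n v r k \<Rightarrow> chain K m (nxt K s (shd (fst \<omega>))) (stl (fst \<omega>), snd \<omega>)
      | Ret n \<Rightarrow> s)"

abbreviation returned :: "state set" where
  "returned \<equiv> range Ret"

lemma chain_Ret [simp]: "chain K m (Ret n) \<omega> = Ret n"
  by (cases m) auto

lemma path_trans:
  "path K s fl gl s' \<Longrightarrow> path K s' fl' gl' s'' \<Longrightarrow> path K s (fl @ fl') (gl @ gl') s''"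
  by (induction rule: path.induct) (auto intro: path.intros)

text \<open>
  The chain, which is driven by streams, and the paths, which are labelled by finite words, are
  two descriptions of the same process. As every step before the end consumes one bit, the word
  lengths measure the number of steps; this is what later bounds flips by steps.
\<close>

lemma chain_path:
  "\<exists>fl gl. path K s fl gl (chain K m s (f, g)) \<and>
     stake (length fl) f = fl \<and> stake (length gl) g = gl \<and> length fl + length gl \<le> m \<and>
     (chain K m s (f, g) \<notin> returned \<longrightarrow> length fl + length gl = m)"
proof (induction m arbitrary: s f g)
  case 0
  show ?case by (rule exI[of _ "[]"], rule exI[of _ "[]"]) (auto intro: path.intros)
next
  case (Suc m)
  show ?case
  proof (cases s)
    case (Geo n)
    obtain fl gl where "path K (nxt K s (shd g)) fl gl (chain K m (nxt K s (shd g)) (f, stl g))"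
      "stake (length fl) f = fl" "stake (length gl) (stl g) = gl" "length fl + length gl \<le> m"
      "chain K m (nxt K s (shd g)) (f, stl g) \<notin> returned \<longrightarrow> length fl + length gl = m"
      using Suc.IH[of "nxt K s (shd g)" f "stl g"] by blast
    moreover have "path K (Geo n) fl (shd g # gl) t" if "path K (nxt K s (shd g)) fl gl t" for t
      using path_gen[of K n "shd g" fl gl t] that Geo by simp
    ultimately show ?thesis using Geo
      by - (rule exI[of _ fl], rule exI[of _ "shd g # gl"], simp del: nxt.simps)
  next
    case (Cmp n v r k)
    obtain fl gl where "path K (nxt K s (shd f)) fl gl (chain K m (nxt K s (shd f)) (stl f, g))"
      "stake (length fl) (stl f) = fl" "stake (length gl) g = gl" "length fl + length gl \<le> m"
      "chain K m (nxt K s (shd f)) (stl f, g) \<notin> returned \<longrightarrow> length fl + length gl = m"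
      using Suc.IH[of "nxt K s (shd f)" "stl f" g] by blast
    moreover have "path K (Cmp n v r k) (shd f # fl) gl t"
      if "path K (nxt K s (shd f)) fl gl t" for t
      using path_flip[of K n v r k "shd f" fl gl t] that Cmp by simp
    ultimately show ?thesis using Cmp
      by - (rule exI[of _ "shd f # fl"], rule exI[of _ gl], simp del: nxt.simps)
  next
    case (Ret n)
    thus ?thesis by (intro exI[of _ "[]"]) (auto intro: path.intros)
  qed
qed

declare chain.simps [simp del]

section \<open>The programs follow the chain\<close>

text \<open>
  At least one step is required, so that a program that passes through \<open>m\<close> requests has run for
  at least \<open>m\<close> steps. This is how an infinite chain is seen to prevent halting.
\<close>

definition leads :: "machine \<Rightarrow> bool stream \<times> bool stream \<Rightarrow> config \<Rightarrow> (config \<Rightarrow> bool) \<Rightarrow> bool" where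
  "leads M \<omega> c Q \<longleftrightarrow> (\<exists>k\<ge>1. Q ((step M \<omega> ^^ k) c))"

lemma leads_now: "Q (step M \<omega> c) \<Longrightarrow> leads M \<omega> c Q"
  unfolding leads_def by (rule exI[of _ 1]) simp

lemma leads_later: "leads M \<omega> (step M \<omega> c) Q \<Longrightarrow> leads M \<omega> c Q"
  unfolding leads_def
proof (elim exE conjE)
  fix k assume "1 \<le> k" "Q ((step M \<omega> ^^ k) (step M \<omega> c))"
  thus "\<exists>k\<ge>1. Q ((step M \<omega> ^^ k) c)"
    by (intro exI[of _ "Suc k"]) (simp add: funpow_swap1)
qed

lemma leads_bind:
  assumes "leads M \<omega> c Q" and "\<And>d. Q d \<Longrightarrow> leads M \<omega> d R"
  shows "leads M \<omega> c R"
proof -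
  obtain k where k: "k \<ge> 1" "Q ((step M \<omega> ^^ k) c)" using assms(1) unfolding leads_def by blast
  obtain l where l: "l \<ge> 1" "R ((step M \<omega> ^^ l) ((step M \<omega> ^^ k) c))"
    using assms(2)[OF k(2)] unfolding leads_def by blast
  show ?thesis unfolding leads_def
    by (rule exI[of _ "l + k"]) (use k l in \<open>simp add: funpow_add\<close>)
qed

text \<open>
  The loop \<open>p: Dec r e; Jump p\<close>, by which the programs clear a register.
\<close>

lemma leads_clear:
  assumes "M ! p = Dec r e" "M ! Suc p = Jump p" "Suc p < length M" "pc c = p"
    and "Q (c\<lparr>pc := e, ints := (ints c)(r := 0)\<rparr>)"
  shows "leads M \<omega> c Q"
  using assms(4,5)
proof (induction "ints c r" arbitrary: c)
  case 0
  have "step M \<omega> c = c\<lparr>pc := e, ints := (ints c)(r := 0)\<rparr>"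
    using 0 assms by (cases c) (auto simp: step_def halted_def fun_eq_iff)
  thus ?case using 0(3) by (intro leads_now[of _ M \<omega> c]) (simp only:)
next
  case (Suc n)
  show ?case
    apply (rule leads_later, rule leads_later)
    apply (rule Suc.hyps(1))
    using Suc(2-) assms(1-3) by (auto simp: step_def halted_def split: if_splits)
qed

fun accept_at :: "kind \<Rightarrow> nat" where
  "accept_at Sorted = 31" | "accept_at MaxFirst = 28"

lemma prog_code [simp]:
  "prog K ! 0 = Dec 0 2" "prog K ! Suc 0 = Jump 0" "prog K ! 2 = Dec 1 4"
  "prog K ! 3 = Jump 2" "prog K ! 4 = Gen 6" "prog K ! 5 = Jump 9"
  "prog K ! 6 = Inc 0" "prog K ! 7 = Inc 1" "prog K ! 8 = Jump 4"
  "prog K ! 9 = Dec 1 (if K = Sorted then accept_at K else 0)"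
  "prog K ! 10 = Dec 2 12" "prog K ! 11 = Jump 10"
  "prog K ! 12 = Truncate 0 2" "prog K ! 13 = Dec 1 (accept_at K)" "prog K ! 14 = Dec 2 16"
  "prog K ! 15 = Jump 14" "prog K ! 16 = Branch 0 2 19 23"
  "prog K ! 17 = Flip (if K = Sorted then 28 else 0)"
  "prog K ! 18 = Jump 21" "prog K ! 19 = Flip 21"
  "prog K ! 20 = Jump (if K = Sorted then 0 else 13)"
  "prog K ! 21 = Inc 2" "prog K ! 22 = Jump 16" "prog K ! 23 = Flip 26"
  "prog K ! 24 = Append 0 False" "prog K ! 25 = Jump 16" "prog K ! 26 = Append 0 True"
  "prog K ! 27 = Jump 16" "prog K ! accept_at K = Write 0"
  by (cases K; simp add: VN_sorted_def VN_max_first_def)+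

lemma prog_code_Sorted [simp]:
  "prog Sorted ! 28 = Truncate 0 2" "prog Sorted ! 29 = Append 0 True" "prog Sorted ! 30 = Jump 13"
  by (simp_all add: VN_sorted_def)

lemma length_prog: "length (prog K) = Suc (accept_at K)"
  by (cases K) (simp_all add: VN_sorted_def VN_max_first_def)

declare prog.simps [simp del]

lemma prog_length [simp]:
  "n < 29 \<Longrightarrow> n < length (prog K)" "n < 32 \<Longrightarrow> n < length (prog Sorted)"
  "accept_at K < length (prog K)" "n < 29 \<Longrightarrow> \<not> length (prog K) \<le> n"
  using length_prog[of K] length_prog[of Sorted] by (cases K; simp)+

lemma step_prog [simp]:
  "pc c < length (prog K) \<Longrightarrow> step (prog K) \<omega> c = exec \<omega> (prog K ! pc c) c"
  by (simp add: step_def halted_def)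

text \<open>
  The program counters 4 and 16 are the heads of the geometric generator and of the digit
  comparison. The register contents left open are overwritten before they are read again.
\<close>

fun represents :: "kind \<Rightarrow> state \<Rightarrow> config \<Rightarrow> bool" where
  "represents K (Geo n) c \<longleftrightarrow> pc c = 4 \<and> ints c 0 = n \<and> ints c 1 = n \<and> outq c = []"
| "represents K (Cmp n v r k) c \<longleftrightarrow>
     pc c = 16 \<and> ints c 0 = n \<and> ints c 1 = k \<and> ints c 2 = length v \<and> strs c 0 = v @ r \<and> outq c = []"
| "represents K (Ret n) c \<longleftrightarrow> halted (prog K) c \<and> outq c = [n]"

definition at_state :: "kind \<Rightarrow> state \<Rightarrow> nat \<Rightarrow> nat \<Rightarrow> config \<Rightarrow> bool" where
  "at_state K s a b c \<longleftrightarrow> represents K s c \<and> nflips c = a \<and> ngens c = b"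

lemma leads_restart:
  assumes "pc c = 0" "outq c = []"
  shows "leads (prog K) \<omega> c (at_state K (Geo 0) (nflips c) (ngens c))"
  by (rule leads_bind, rule leads_clear[where p = 0 and r = 0 and e = 2 and
        Q = "\<lambda>d. d = c\<lparr>pc := 2, ints := (ints c)(0 := 0)\<rparr>"];
      (rule leads_clear[where p = 2 and r = 1 and e = 4])?)
     (simp_all add: assms at_state_def)

lemma leads_accept:
  assumes "pc c = accept_at K" "outq c = []" "ints c 0 = n"
  shows "leads (prog K) \<omega> c (at_state K (Ret n) (nflips c) (ngens c))"
  by (rule leads_now) (simp add: assms at_state_def halted_def length_prog)

lemma leads_pass:
  assumes "pc c = 13" "outq c = []" "ints c 0 = n" "ints c 1 = k" "strs c 0 = w"
  shows "leads (prog K) \<omega> c (at_state K (pass n w k) (nflips c) (ngens c))"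
proof (cases k)
  case 0
  have "leads (prog K) \<omega> (step (prog K) \<omega> c) (at_state K (Ret n) (nflips c) (ngens c))"
    using leads_accept[of "step (prog K) \<omega> c" K n \<omega>] assms 0 by simp
  thus ?thesis unfolding pass_def 0 by (auto intro: leads_later)
next
  case (Suc k')
  show ?thesis
    by (rule leads_later, rule leads_clear[where p = 14 and r = 2 and e = 16])
       (use assms Suc in \<open>simp_all add: at_state_def pass_def\<close>)
qed

lemma leads_trial:
  assumes "pc c = 9" "outq c = []" "ints c 0 = n" "ints c 1 = n"
  shows "leads (prog K) \<omega> c (at_state K (trial K n) (nflips c) (ngens c))"
proof (cases n)
  case 0
  show ?thesis
  proof (cases K)
    case Sorted
    have "leads (prog K) \<omega> (step (prog K) \<omega> c) (at_state K (Ret n) (nflips c) (ngens c))"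
      using leads_accept[of "step (prog K) \<omega> c" K n \<omega>] assms 0 Sorted by simp
    thus ?thesis using 0 Sorted unfolding trial_def by (auto intro: leads_later)
  next
    case MaxFirst
    have "leads (prog K) \<omega> (step (prog K) \<omega> c) (at_state K (Geo 0) (nflips c) (ngens c))"
      using leads_restart[of "step (prog K) \<omega> c" K \<omega>] assms 0 MaxFirst by simp
    thus ?thesis using 0 MaxFirst unfolding trial_def by (auto intro: leads_later)
  qed
next
  case (Suc m)
  define e where "e = c\<lparr>pc := 12, ints := (ints c)(1 := m, 2 := 0)\<rparr>"
  have "leads (prog K) \<omega> (step (prog K) \<omega> e) (at_state K (trial K n) (nflips c) (ngens c))"
    using leads_pass[of "step (prog K) \<omega> e" n m "[]" K \<omega>] assms Suc by (simp add: trial_def e_def)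
  hence e: "leads (prog K) \<omega> e (at_state K (trial K n) (nflips c) (ngens c))"
    by (rule leads_later)
  have "leads (prog K) \<omega> (step (prog K) \<omega> c) (\<lambda>d. d = e)"
    by (rule leads_clear[where p = 10 and r = 2 and e = 12])
       (use assms Suc in \<open>simp_all add: e_def\<close>)
  thus ?thesis using e by (auto intro: leads_later leads_bind)
qed

lemma macro_Geo:
  assumes "represents K (Geo n) c"
  shows "leads (prog K) (f, g) c
           (at_state K (nxt K (Geo n) (g !! ngens c)) (nflips c) (Suc (ngens c)))"
proof (cases "g !! ngens c")
  case True
  show ?thesis
    by (rule leads_later, rule leads_later, rule leads_later, rule leads_now)
       (use True assms in \<open>simp add: at_state_def\<close>)
next
  case False
  let ?d = "step (prog K) (f, g) (step (prog K) (f, g) c)"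
  have "leads (prog K) (f, g) ?d (at_state K (trial K n) (nflips ?d) (ngens ?d))"
    by (rule leads_trial) (use False assms in simp_all)
  thus ?thesis using False assms
    by (intro leads_later[of _ _ c] leads_later[of _ _ "step _ _ c"]) simp
qed

text \<open>
  The cases are the ways through the instructions from 16 on: a fresh digit for the champion
  (\<open>r = []\<close>), equal digits, and for each program the two ways in which digits can differ.
\<close>

lemma macro_Cmp:
  assumes "represents K (Cmp n v r k) c"
  shows "leads (prog K) (f, g) c
           (at_state K (nxt K (Cmp n v r k) (f !! nflips c)) (Suc (nflips c)) (ngens c))"
proof (cases r)
  case Nil
  show ?thesis
    by (rule leads_later, rule leads_later, rule leads_later, rule leads_now)
       (use Nil assms in \<open>cases "f !! nflips c"; simp add: at_state_def\<close>)
next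
  case (Cons x r')
  let ?b = "f !! nflips c" and ?s = "step (prog K) (f, g)"
  show ?thesis
  proof (cases "?b = x")
    case True
    show ?thesis
    proof (cases x)
      case x: True
      show ?thesis
        by (rule leads_later, rule leads_later, rule leads_later, rule leads_now)
           (use Cons True x assms in \<open>simp add: at_state_def\<close>)
    next
      case x: False
      show ?thesis
        by (rule leads_later, rule leads_later, rule leads_later, rule leads_later, rule leads_now)
           (use Cons True x assms in \<open>simp add: at_state_def\<close>)
    qed
  next
    case ne: False
    consider "K = Sorted" "x" | "K = MaxFirst" "\<not> x" | "K = Sorted" "\<not> x" | "K = MaxFirst" "x"
      by (cases K; cases x) auto
    thus ?thesis
    proof cases
      case 1
      have "leads (prog K) (f, g) ((?s ^^ 3) c)
              (at_state K (Geo 0) (nflips ((?s ^^ 3) c)) (ngens ((?s ^^ 3) c)))"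
        by (rule leads_restart) (use 1 ne Cons assms in \<open>simp_all add: numeral_3_eq_3\<close>)
      hence "leads (prog K) (f, g) (?s (?s (?s c))) (at_state K (Geo 0) (Suc (nflips c)) (ngens c))"
        using 1 ne Cons assms by (simp add: numeral_3_eq_3)
      hence "leads (prog K) (f, g) c (at_state K (Geo 0) (Suc (nflips c)) (ngens c))"
        by (intro leads_later[of _ _ c] leads_later[of _ _ "?s c"] leads_later[of _ _ "?s (?s c)"])
      thus ?thesis using 1 ne Cons by simp
    next
      case 2
      have "leads (prog K) (f, g) (?s (?s c))
              (at_state K (Geo 0) (nflips (?s (?s c))) (ngens (?s (?s c))))"
        by (rule leads_restart) (use 2 ne Cons assms in simp_all)
      hence "leads (prog K) (f, g) (?s (?s c)) (at_state K (Geo 0) (Suc (nflips c)) (ngens c))"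
        using 2 ne Cons assms by simp
      hence "leads (prog K) (f, g) c (at_state K (Geo 0) (Suc (nflips c)) (ngens c))"
        by (intro leads_later[of _ _ c] leads_later[of _ _ "?s c"])
      thus ?thesis using 2 ne Cons by simp
    next
      case 3
      let ?d = "?s (?s (?s (?s (?s c))))"
      have "leads (prog K) (f, g) ?d (at_state K (pass n (v @ [True]) k) (nflips ?d) (ngens ?d))"
        by (rule leads_pass) (use 3 ne Cons assms in simp_all)
      hence "leads (prog K) (f, g) ?d
               (at_state K (pass n (v @ [True]) k) (Suc (nflips c)) (ngens c))"
        using 3 ne Cons assms by simp
      hence "leads (prog K) (f, g) c
               (at_state K (pass n (v @ [True]) k) (Suc (nflips c)) (ngens c))"
        by (intro leads_later[of _ _ c] leads_later[of _ _ "?s c"] leads_later[of _ _ "?s (?s c)"]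
              leads_later[of _ _ "?s (?s (?s c))"] leads_later[of _ _ "?s (?s (?s (?s c)))"])
      thus ?thesis using 3 ne Cons by simp
    next
      case 4
      let ?d = "?s (?s (?s c))"
      have "leads (prog K) (f, g) ?d (at_state K (pass n (v @ True # r') k) (nflips ?d) (ngens ?d))"
        by (rule leads_pass) (use 4 ne Cons assms in simp_all)
      hence "leads (prog K) (f, g) ?d
               (at_state K (pass n (v @ True # r') k) (Suc (nflips c)) (ngens c))"
        using 4 ne Cons assms by simp
      hence "leads (prog K) (f, g) c
               (at_state K (pass n (v @ True # r') k) (Suc (nflips c)) (ngens c))"
        by (intro leads_later[of _ _ c] leads_later[of _ _ "?s c"] leads_later[of _ _ "?s (?s c)"])
      thus ?thesis using 4 ne Cons by simp
    qed
  qed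
qed

lemma path_machine:
  assumes "path K s fl gl s'" "represents K s c"
    and "stake (length fl) (sdrop (nflips c) f) = fl" "stake (length gl) (sdrop (ngens c) g) = gl"
  shows "\<exists>k\<ge>length fl + length gl.
           at_state K s' (nflips c + length fl) (ngens c + length gl) ((step (prog K) (f, g) ^^ k) c)"
  using assms
proof (induction arbitrary: c rule: path.induct)
  case (path_refl s)
  thus ?case by (intro exI[of _ 0]) (simp add: at_state_def)
next
  case (path_gen n b fl gl s)
  have b: "g !! ngens c = b" using path_gen.prems(3) by simp
  obtain j where j: "j \<ge> 1" "at_state K (nxt K (Geo n) b) (nflips c) (Suc (ngens c))
      ((step (prog K) (f, g) ^^ j) c)"
    using macro_Geo[OF path_gen.prems(1), of f g] unfolding leads_def b by blast
  obtain k where k: "k \<ge> length fl + length gl"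
    "at_state K s (nflips c + length fl) (Suc (ngens c) + length gl)
       ((step (prog K) (f, g) ^^ k) ((step (prog K) (f, g) ^^ j) c))"
    using path_gen.IH[of "(step (prog K) (f, g) ^^ j) c"] j(2) path_gen.prems
    by (auto simp: at_state_def simp del: nxt.simps)
  show ?case by (rule exI[of _ "k + j"]) (use j k in \<open>simp add: funpow_add\<close>)
next
  case (path_flip n v r k' b fl gl s)
  have b: "f !! nflips c = b" using path_flip.prems(2) by simp
  obtain j where j: "j \<ge> 1" "at_state K (nxt K (Cmp n v r k') b) (Suc (nflips c)) (ngens c)
      ((step (prog K) (f, g) ^^ j) c)"
    using macro_Cmp[OF path_flip.prems(1), of f g] unfolding leads_def b by blast
  obtain k where k: "k \<ge> length fl + length gl"
    "at_state K s (Suc (nflips c) + length fl) (ngens c + length gl)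
       ((step (prog K) (f, g) ^^ k) ((step (prog K) (f, g) ^^ j) c))"
    using path_flip.IH[of "(step (prog K) (f, g) ^^ j) c"] j(2) path_flip.prems
    by (auto simp: at_state_def simp del: nxt.simps)
  show ?case by (rule exI[of _ "k + j"]) (use j k in \<open>simp add: funpow_add\<close>)
qed

lemma path_run:
  assumes "path K (Geo 0) fl gl s" "stake (length fl) f = fl" "stake (length gl) g = gl"
  shows "\<exists>k\<ge>length fl + length gl. at_state K s (length fl) (length gl) (run (prog K) (f, g) k)"
proof -
  obtain j where j: "at_state K (Geo 0) 0 0 ((step (prog K) (f, g) ^^ j) init)"
    using leads_restart[of init K "(f, g)"] unfolding leads_def by (auto simp: init_def)
  obtain k where k: "k \<ge> length fl + length gl"
    "at_state K s (length fl) (length gl)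
       ((step (prog K) (f, g) ^^ k) ((step (prog K) (f, g) ^^ j) init))"
    using path_machine[OF assms(1), of "(step (prog K) (f, g) ^^ j) init" f g] j assms(2,3)
    by (auto simp: at_state_def)
  show ?thesis
    by (rule exI[of _ "k + j"]) (use k in \<open>simp add: funpow_add run_def\<close>)
qed

lemma run_halted:
  assumes "halted M (run M \<omega> m)" "m \<le> n"
  shows "run M \<omega> n = run M \<omega> m"
  using assms(2)
proof (induction rule: dec_induct)
  case (step n)
  thus ?case using assms(1) by (simp add: run_def step_def)
qed simp

lemma run_halted_unique:
  assumes "halted M (run M \<omega> m)" "halted M (run M \<omega> n)"
  shows "run M \<omega> m = run M \<omega> n"
  using run_halted[OF assms(1), of n] run_halted[OF assms(2), of m] by (cases "m \<le> n") auto

lemma represents_halted: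
  assumes "represents K s c"
  shows "halted (prog K) c \<longleftrightarrow> s \<in> returned"
proof (cases s)
  case (Geo n)
  thus ?thesis using assms by (auto simp: halted_def)
next
  case (Cmp n v r k)
  thus ?thesis using assms by (auto simp: halted_def)
qed (use assms in auto)

lemma chain_run:
  obtains fl gl k where "path K (Geo 0) fl gl (chain K m (Geo 0) (f, g))"
    "stake (length fl) f = fl" "stake (length gl) g = gl" "length fl + length gl \<le> m"
    "chain K m (Geo 0) (f, g) \<notin> returned \<longrightarrow> k \<ge> m"
    "at_state K (chain K m (Geo 0) (f, g)) (length fl) (length gl) (run (prog K) (f, g) k)"
proof -
  obtain fl gl where *: "path K (Geo 0) fl gl (chain K m (Geo 0) (f, g))"
    "stake (length fl) f = fl" "stake (length gl) g = gl" "length fl + length gl \<le> m"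
    "chain K m (Geo 0) (f, g) \<notin> returned \<longrightarrow> length fl + length gl = m"
    using chain_path[of K "Geo 0" m f g] by (elim exE conjE) (rule that)
  obtain k where "k \<ge> length fl + length gl"
    "at_state K (chain K m (Geo 0) (f, g)) (length fl) (length gl) (run (prog K) (f, g) k)"
    using path_run[OF *(1-3)] by (elim exE conjE) (rule that)
  thus ?thesis using * by (intro that[of fl gl k] impI) simp_all
qed

text \<open>
  If the chain were still running after \<open>n + 1\<close> decisions, the program would be at a request,
  and hence not halted, at some time later than \<open>n\<close>.
\<close>

lemma halted_chain:
  assumes "halted (prog K) (run (prog K) (f, g) n)"
  shows "chain K (Suc n) (Geo 0) (f, g) \<in> returned"
proof (rule ccontr)
  assume alive: "chain K (Suc n) (Geo 0) (f, g) \<notin> returned"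
  obtain fl gl k where run: "path K (Geo 0) fl gl (chain K (Suc n) (Geo 0) (f, g))"
    "stake (length fl) f = fl" "stake (length gl) g = gl" "length fl + length gl \<le> Suc n"
    "chain K (Suc n) (Geo 0) (f, g) \<notin> returned \<longrightarrow> k \<ge> Suc n"
    "at_state K (chain K (Suc n) (Geo 0) (f, g)) (length fl) (length gl) (run (prog K) (f, g) k)"
    by (rule chain_run[where K = K and m = "Suc n" and f = f and g = g])
  have k: "k \<ge> Suc n" "represents K (chain K (Suc n) (Geo 0) (f, g)) (run (prog K) (f, g) k)"
    using mp[OF run(5) alive] run(6) by (simp_all only: at_state_def)
  have "run (prog K) (f, g) k = run (prog K) (f, g) n" using k(1)
    by (intro run_halted[OF assms]) simp
  thus False using represents_halted[OF k(2)] alive assms by simp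
qed

text \<open>
  From left to right: by \<open>halted_chain\<close> the chain has returned, so there is a path to a returned
  value; following it the program halts too, and a halted configuration is unique.
\<close>

theorem machine_path:
  "(\<exists>n. halted (prog K) (run (prog K) (f, g) n) \<and> outq (run (prog K) (f, g) n) = out \<and>
        nflips (run (prog K) (f, g) n) = nf \<and> ngens (run (prog K) (f, g) n) = ng) \<longleftrightarrow>
   (\<exists>N. out = [N] \<and> path K (Geo 0) (stake nf f) (stake ng g) (Ret N))"
proof (intro iffI; elim exE conjE)
  fix n
  assume h: "halted (prog K) (run (prog K) (f, g) n)"
    and o: "outq (run (prog K) (f, g) n) = out" "nflips (run (prog K) (f, g) n) = nf"
      "ngens (run (prog K) (f, g) n) = ng"
  obtain N where N: "chain K (Suc n) (Geo 0) (f, g) = Ret N" using halted_chain[OF h] by blast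
  obtain fl gl k where run: "path K (Geo 0) fl gl (chain K (Suc n) (Geo 0) (f, g))"
    "stake (length fl) f = fl" "stake (length gl) g = gl" "length fl + length gl \<le> Suc n"
    "chain K (Suc n) (Geo 0) (f, g) \<notin> returned \<longrightarrow> k \<ge> Suc n"
    "at_state K (chain K (Suc n) (Geo 0) (f, g)) (length fl) (length gl) (run (prog K) (f, g) k)"
    by (rule chain_run[where K = K and m = "Suc n" and f = f and g = g])
  note k = run(1-3,6)[unfolded N]
  have "run (prog K) (f, g) k = run (prog K) (f, g) n"
    using k(4) h by (intro run_halted_unique) (auto simp: at_state_def)
  hence "out = [N]" "nf = length fl" "ng = length gl" using k(4) o by (auto simp: at_state_def)
  thus "\<exists>N. out = [N] \<and> path K (Geo 0) (stake nf f) (stake ng g) (Ret N)" using k by simp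
next
  fix N assume "out = [N]" "path K (Geo 0) (stake nf f) (stake ng g) (Ret N)"
  thus "\<exists>n. halted (prog K) (run (prog K) (f, g) n) \<and> outq (run (prog K) (f, g) n) = out \<and>
        nflips (run (prog K) (f, g) n) = nf \<and> ngens (run (prog K) (f, g) n) = ng"
    using path_run[of K "stake nf f" "stake ng g" "Ret N" f g] by (auto simp: at_state_def)
qed

lemma chain_Ret_result:
  assumes "chain K m (Geo 0) \<omega> = Ret N"
  shows "halts (prog K) \<omega>" "result (prog K) \<omega> = [N]" "total_flips (prog K) \<omega> \<le> m"
proof -
  obtain f g where w: "\<omega> = (f, g)" by fastforce
  obtain fl gl k where run: "path K (Geo 0) fl gl (chain K m (Geo 0) (f, g))"
    "stake (length fl) f = fl" "stake (length gl) g = gl" "length fl + length gl \<le> m"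
    "chain K m (Geo 0) (f, g) \<notin> returned \<longrightarrow> k \<ge> m"
    "at_state K (chain K m (Geo 0) (f, g)) (length fl) (length gl) (run (prog K) (f, g) k)"
    by (rule chain_run[where K = K and m = m and f = f and g = g])
  define a where "a = length fl"
  define b where "b = length gl"
  have k: "at_state K (Ret N) a b (run (prog K) \<omega> k)" "a + b \<le> m"
    using run(4,6) assms by (simp_all only: w a_def b_def)
  have h: "halted (prog K) (run (prog K) \<omega> k)" using k(1) by (simp add: at_state_def)
  thus halts: "halts (prog K) \<omega>" by (auto simp: halts_def)
  define l where "l = (LEAST n. halted (prog K) (run (prog K) \<omega> n))"
  have "halted (prog K) (run (prog K) \<omega> l)" unfolding l_def using h by (rule LeastI)
  hence "run (prog K) \<omega> l = run (prog K) \<omega> k" using h by (rule run_halted_unique)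
  thus "result (prog K) \<omega> = [N]" using halts k(1) by (simp add: result_def l_def at_state_def)
  have mono: "nflips c \<le> nflips (step (prog K) \<omega> c)" for c
    by (cases "prog K ! pc c") (auto simp: step_def split: list.splits)
  have "nflips (run (prog K) \<omega> n) \<le> m" for n
  proof (cases "k \<le> n")
    case True
    thus ?thesis using run_halted[OF h True] k by (simp add: at_state_def)
  next
    case False
    have incr: "nflips (run (prog K) \<omega> i) \<le> nflips (run (prog K) \<omega> (Suc i))" for i
      using mono by (simp add: run_def)
    have "nflips (run (prog K) \<omega> n) \<le> nflips (run (prog K) \<omega> k)"
      by (rule lift_Suc_mono_le[of "\<lambda>i. nflips (run (prog K) \<omega> i)", OF incr])
         (use False in simp)
    thus ?thesis using k by (simp add: at_state_def)
  qed
  thus "total_flips (prog K) \<omega> \<le> m" by (auto simp: total_flips_def intro: SUP_least)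
qed

lemma halts_chain: "halts (prog K) \<omega> \<longleftrightarrow> (\<exists>m. chain K m (Geo 0) \<omega> \<in> returned)"
  using halted_chain[of K "fst \<omega>" "snd \<omega>"] chain_Ret_result(1)[of K _ \<omega>]
  unfolding halts_def by (metis prod.collapse rangeE)

section \<open>Digits and dyadic intervals\<close>

definition lower :: "bool list \<Rightarrow> real" where
  "lower w = (\<Sum>i<length w. of_bool (w ! i) / 2 ^ Suc i)"

abbreviation upper :: "bool list \<Rightarrow> real" where
  "upper w \<equiv> lower w + 1 / 2 ^ length w"

lemma cylinder_eq: "cylinder w = {lower w..<upper w}"
  by (simp add: cylinder_def lower_def Let_def)

lemma lower_Nil [simp]: "lower [] = 0"
  by (simp add: lower_def)

lemma lower_append: "lower (v @ w) = lower v + lower w / 2 ^ length v"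
proof -
  have "lower (v @ w) = (\<Sum>i<length v. of_bool ((v @ w) ! i) / 2 ^ Suc i) +
      (\<Sum>i<length w. of_bool ((v @ w) ! (length v + i)) / 2 ^ Suc (length v + i))"
    unfolding lower_def by (simp add: sum.nat_group[symmetric] lessThan_atLeast0
        sum.atLeastLessThan_concat[of 0 "length v" "length v + length w", symmetric]
        sum.atLeastLessThan_shift_0[of _ "length v" "length v + length w"])
  thus ?thesis
    by (simp add: lower_def sum_divide_distrib power_add mult_ac nth_append)
qed

lemma lower_Cons: "lower (b # w) = of_bool b / 2 + lower w / 2"
  using lower_append[of "[b]" w] by (simp add: lower_def)

lemma lower_snoc: "lower (v @ [b]) = lower v + of_bool b / 2 ^ Suc (length v)"
  by (simp add: lower_append lower_Cons)

lemma lower_bounds: "0 \<le> lower w" "upper w \<le> 1"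
proof (induction w)
  case (Cons b w)
  have "upper (b # w) = of_bool b / 2 + upper w / 2" by (simp add: lower_Cons add_divide_distrib)
  thus "0 \<le> lower (b # w)" "upper (b # w) \<le> 1" using Cons by (auto simp: lower_Cons)
qed simp_all

lemma lower_append_bounds: "lower v \<le> lower (v @ w)" "upper (v @ w) \<le> upper v"
proof -
  have "lower (v @ w) + 1 / 2 ^ length (v @ w) = lower v + upper w / 2 ^ length v"
    by (simp add: lower_append power_add add_divide_distrib mult.commute)
  also have "\<dots> \<le> lower v + 1 / 2 ^ length v"
    using lower_bounds(2)[of w] by (intro add_left_mono divide_right_mono) auto
  finally show "upper (v @ w) \<le> upper v" .
qed (use lower_bounds[of w] in \<open>auto simp: lower_append\<close>)

lemma cylinder_append: "cylinder (v @ w) \<subseteq> cylinder v"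
  using lower_append_bounds[of v w] by (auto simp: cylinder_eq)

text \<open>
  The known digits already show that the first number is less than the second one.
\<close>

definition below :: "bool list \<Rightarrow> bool list \<Rightarrow> bool" where
  "below x y \<longleftrightarrow> (\<exists>p x' y'. x = p @ False # x' \<and> y = p @ True # y')"

lemma belowI: "below (p @ False # x) (p @ True # y)"
  by (auto simp: below_def)

lemma below_append: "below x y \<Longrightarrow> below (x @ x') (y @ y')"
  unfolding below_def by force

lemma below_not_prefix:
  assumes "below x y" shows "\<not> prefix x y" "\<not> prefix y x"
  using assms unfolding below_def prefix_def by auto

lemma below_cylinder:
  assumes "below x y" "a \<in> cylinder x" "b \<in> cylinder y"
  shows "a < b"
proof -
  obtain p x' y' where *: "x = p @ False # x'" "y = p @ True # y'"
    using assms(1) unfolding below_def by blast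
  have "x = (p @ [False]) @ x'" "y = (p @ [True]) @ y'" using * by auto
  hence "a \<in> cylinder (p @ [False])" "b \<in> cylinder (p @ [True])"
    using assms(2,3) cylinder_append by blast+
  thus ?thesis by (auto simp: cylinder_eq lower_snoc)
qed

lemma infinite_cylinder: "infinite (cylinder w)"
  by (simp add: cylinder_eq infinite_Ico)

section \<open>Order tests as sequences of comparisons\<close>

text \<open>
  The number with which coordinate \<open>j\<close> is compared, for \<open>j \<ge> 1\<close>; coordinates are counted from 0.
\<close>

fun champ :: "kind \<Rightarrow> nat \<Rightarrow> nat" where
  "champ Sorted j = j - 1"
| "champ MaxFirst j = 0"

text \<open>
  The first argument is the champion, the second one the newcomer.
\<close>

fun passes :: "kind \<Rightarrow> real \<Rightarrow> real \<Rightarrow> bool" where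
  "passes Sorted x y \<longleftrightarrow> x < y"
| "passes MaxFirst x y \<longleftrightarrow> y < x"

fun won :: "kind \<Rightarrow> bool list \<Rightarrow> bool list \<Rightarrow> bool" where
  "won Sorted x y \<longleftrightarrow> below x y"
| "won MaxFirst x y \<longleftrightarrow> below y x"

lemma champ_less: "1 \<le> j \<Longrightarrow> champ K j < j"
  by (cases K) auto

lemma champ_less_length: "1 \<le> j \<Longrightarrow> j < n \<Longrightarrow> champ K j < n"
  using champ_less[of j K] by linarith

lemma rank_less_iff:
  fixes u :: "real list"
  assumes "x \<in> set u" "y \<in> set u"
  shows "card {z \<in> set u. z \<le> x} < card {z \<in> set u. z \<le> y} \<longleftrightarrow> x < y"
proof -
  have *: "card {z \<in> set u. z \<le> x} < card {z \<in> set u. z \<le> y}" if "x < y" "y \<in> set u" for x y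
  proof (rule psubset_card_mono)
    have "y \<in> {z \<in> set u. z \<le> y} - {z \<in> set u. z \<le> x}" using that by auto
    moreover have "{z \<in> set u. z \<le> x} \<subseteq> {z \<in> set u. z \<le> y}" using that by auto
    ultimately show "{z \<in> set u. z \<le> x} \<subset> {z \<in> set u. z \<le> y}" by blast
  qed simp
  have "card {z \<in> set u. z \<le> y} \<le> card {z \<in> set u. z \<le> x}" if "y \<le> x"
    using that by (intro card_mono) auto
  thus ?thesis using *[of x y] assms by force
qed

lemma order_type_permutation:
  assumes "distinct u" shows "order_type u \<in> permutation_words"
proof -
  have inj: "inj_on (\<lambda>x. card {y \<in> set u. y \<le> x}) (set u)"
  proof (rule inj_onI)
    fix x y assume "x \<in> set u" "y \<in> set u" "card {z \<in> set u. z \<le> x} = card {z \<in> set u. z \<le> y}"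
    thus "x = y" using rank_less_iff[of x u y] rank_less_iff[of y u x] by force
  qed
  have "card {y \<in> set u. y \<le> x} \<in> {1..length u}" if "x \<in> set u" for x
  proof -
    have "card {y \<in> set u. y \<le> x} \<le> card (set u)" by (intro card_mono) auto
    moreover have "card {y \<in> set u. y \<le> x} > 0" using that by (auto simp: card_gt_0_iff)
    ultimately show ?thesis using card_length[of u] by simp
  qed
  hence "set (order_type u) \<subseteq> {1..length u}" by (auto simp: order_type_def)
  moreover have "card (set (order_type u)) = length u"
    using inj assms by (simp add: order_type_def card_image distinct_card)
  ultimately have "set (order_type u) = {1..length u}" by (intro card_subset_eq) auto
  moreover have "distinct (order_type u)" using inj assms by (simp add: order_type_def distinct_map)
  ultimately show ?thesis by (simp add: permutation_words_def order_type_def)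
qed

text \<open>
  For sorted permutations it is enough to compare neighbours, by transitivity; the greatest rank
  is the one of the greatest number.
\<close>

lemma order_type_perms:
  assumes "distinct u"
  shows "order_type u \<in> perms K \<longleftrightarrow>
    (u = [] \<longrightarrow> K = Sorted) \<and> (\<forall>j. 1 \<le> j \<and> j < length u \<longrightarrow> passes K (u ! champ K j) (u ! j))"
proof (cases K)
  case Sorted
  have "sorted (order_type u) \<longleftrightarrow> sorted_wrt (<) (order_type u)"
    using order_type_permutation[OF assms] by (auto simp: strict_sorted_iff permutation_words_def)
  also have "\<dots> \<longleftrightarrow> (\<forall>i. Suc i < length u \<longrightarrow> u ! i < u ! Suc i)"
    by (auto simp: sorted_wrt_iff_nth_Suc_transp order_type_def rank_less_iff)
  also have "\<dots> \<longleftrightarrow> (\<forall>j. 1 \<le> j \<and> j < length u \<longrightarrow> u ! (j - 1) < u ! j)"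
  proof (intro iffI allI impI; (elim conjE)?)
    fix j assume "\<forall>i. Suc i < length u \<longrightarrow> u ! i < u ! Suc i" "1 \<le> j" "j < length u"
    thus "u ! (j - 1) < u ! j" by (cases j) auto
  next
    fix i assume "\<forall>j. 1 \<le> j \<and> j < length u \<longrightarrow> u ! (j - 1) < u ! j" "Suc i < length u"
    thus "u ! i < u ! Suc i" by (auto dest: spec[of _ "Suc i"])
  qed
  finally show ?thesis
    using Sorted order_type_permutation[OF assms] by (simp add: sorted_perms_def)
next
  case MaxFirst
  show ?thesis
  proof (cases u)
    case Nil
    thus ?thesis using MaxFirst by (auto simp: max_first_perms_def order_type_def)
  next
    case (Cons x u')
    let ?r = "\<lambda>x. card {y \<in> set u. y \<le> x}"
    have "hd (order_type u) = Max (set (order_type u)) \<longleftrightarrow> (\<forall>y\<in>set u. ?r y \<le> ?r x)"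
      by (subst eq_commute, subst Max_eq_iff) (auto simp: order_type_def Cons)
    also have "\<dots> \<longleftrightarrow> (\<forall>y\<in>set u. \<not> x < y)"
      using rank_less_iff[of x u] Cons
        by (intro ball_cong refl) (simp only: not_less[symmetric] list.set_intros)
    also have "\<dots> \<longleftrightarrow> (\<forall>y\<in>set u'. y < x)"
      using assms Cons by (auto simp: not_less le_less)
    also have "\<dots> \<longleftrightarrow> (\<forall>j. 1 \<le> j \<and> j < length u \<longrightarrow> u ! j < u ! 0)"
      unfolding all_set_conv_all_nth
      by (auto simp: Cons less_Suc_eq_0_disj)
    finally show ?thesis
      using MaxFirst Cons order_type_permutation[OF assms]
      by (simp add: max_first_perms_def order_type_def)
  qed
qed

lemma won_passes:
  assumes "won K x y" "a \<in> cylinder x" "b \<in> cylinder y" shows "passes K a b"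
  using assms below_cylinder by (cases K) auto

lemma won_append: "won K x y \<Longrightarrow> won K (x @ x') (y @ y')"
  using below_append by (cases K) auto

lemma won_not_prefix: "won K x y \<Longrightarrow> \<not> prefix y x"
  using below_not_prefix by (cases K) auto

lemma passes_asym: "passes K a b \<Longrightarrow> \<not> passes K b a"
  by (cases K) auto

section \<open>A query rule that follows the chain\<close>

text \<open>
  The knowledge \<open>ws\<close> about the \<open>N\<close> numbers that the chain has in state \<open>s\<close>. In a comparison
  state all comparisons before the current one have been won, and nothing is known of later
  numbers. In the state \<open>Geo 0\<close> that ends a failed trial some comparison is known to be lost, or
  a maximum is asked for where there are no numbers.
\<close>

fun matches :: "kind \<Rightarrow> nat \<Rightarrow> bool list list \<Rightarrow> state \<Rightarrow> bool" where
  "matches K N ws (Geo n) \<longleftrightarrow> length ws = N \<and> n = 0 \<and>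
     (N = 0 \<and> K = MaxFirst \<or> (\<exists>i. 1 \<le> i \<and> i < N \<and> won K (ws ! i) (ws ! champ K i)))"
| "matches K N ws (Cmp n v r k) \<longleftrightarrow> length ws = N \<and> n = N \<and>
     (\<exists>j. 1 \<le> j \<and> j + k + 1 = N \<and> ws ! champ K j = v @ r \<and> ws ! j = v \<and>
       (\<forall>i. 1 \<le> i \<and> i < j \<longrightarrow> won K (ws ! champ K i) (ws ! i)) \<and>
       (\<forall>i. j < i \<and> i < N \<longrightarrow> ws ! i = []))"
| "matches K N ws (Ret n) \<longleftrightarrow> length ws = N \<and> n = N \<and> (N = 0 \<longrightarrow> K = Sorted) \<and>
     (\<forall>i. 1 \<le> i \<and> i < N \<longrightarrow> won K (ws ! champ K i) (ws ! i))"

text \<open>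
  The rule recovers the state of the chain from the known digits alone: the current comparison
  is the first one that the digits leave open, that is, in which the newcomer is a prefix of its
  champion. If the two strings are equal, the next digit of the champion is drawn, otherwise one
  of the newcomer.
\<close>

definition query :: "kind \<Rightarrow> bool list list \<Rightarrow> nat" where
  "query K ws =
     (let j = LEAST j. 1 \<le> j \<and> prefix (ws ! j) (ws ! champ K j)
      in if ws ! j = ws ! champ K j then champ K j else j)"

lemma matches_trial: "matches K N (replicate N []) (trial K N)"
proof (cases K)
  case Sorted
  thus ?thesis by (cases N; cases "N - 1") (auto simp: trial_def pass_def intro!: exI[of _ 1])
next
  case MaxFirst
  thus ?thesis by (cases N; cases "N - 1") (auto simp: trial_def pass_def intro!: exI[of _ 1])
qed

lemma query_eq:
  assumes "1 \<le> j" "ws ! champ K j = v @ r" "ws ! j = v"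
    and "\<forall>i. 1 \<le> i \<and> i < j \<longrightarrow> won K (ws ! champ K i) (ws ! i)"
  shows "query K ws = (if r = [] then champ K j else j)"
proof -
  have "(LEAST j. 1 \<le> j \<and> prefix (ws ! j) (ws ! champ K j)) = j"
    using assms won_not_prefix by (intro Least_equality) (force simp: not_less[symmetric])+
  thus ?thesis using assms by (simp add: query_def)
qed

lemma matches_pass:
  assumes "length ws = N" "1 \<le> j" "j + k + 1 = N"
    and "\<forall>i. 1 \<le> i \<and> i \<le> j \<longrightarrow> won K (ws ! champ K i) (ws ! i)"
    and "\<forall>i. j < i \<and> i < N \<longrightarrow> ws ! i = []"
    and "ws ! champ K (Suc j) = w"
  shows "matches K N ws (pass N w k)"
proof (cases k)
  case 0
  thus ?thesis using assms by (auto simp: pass_def)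
next
  case (Suc k')
  thus ?thesis using assms by (auto simp: pass_def less_Suc_eq_le intro!: exI[of _ "Suc j"])
qed

text \<open>
  Digits are only ever appended, so the comparisons that were won before stay won
  (\<open>won_append\<close>).
\<close>

lemma matches_nxt:
  assumes "matches K N ws (Cmp n v r k)"
  shows "matches K N (ws[query K ws := ws ! query K ws @ [b]]) (nxt K (Cmp n v r k) b)"
proof -
  obtain j where j: "length ws = N" "n = N" "1 \<le> j" "j + k + 1 = N" "ws ! champ K j = v @ r"
      "ws ! j = v" "\<forall>i. 1 \<le> i \<and> i < j \<longrightarrow> won K (ws ! champ K i) (ws ! i)"
      "\<forall>i. j < i \<and> i < N \<longrightarrow> ws ! i = []"
    using assms by auto
  have q: "query K ws = (if r = [] then champ K j else j)" by (rule query_eq) (use j in auto)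
  have c: "champ K j < j" using j(3) by (rule champ_less)
  define ws' where "ws' = ws[query K ws := ws ! query K ws @ [b]]"
  have len: "length ws' = N" using j by (simp add: ws'_def)
  have app: "\<exists>x. ws' ! i = ws ! i @ x" if "i < N" for i
    using that j(1) by (cases "i = query K ws") (auto simp: ws'_def)
  have won': "\<forall>i. 1 \<le> i \<and> i < j \<longrightarrow> won K (ws' ! champ K i) (ws' ! i)"
  proof (intro allI impI; elim conjE)
    fix i assume i: "1 \<le> i" "i < j"
    obtain x y where "ws' ! champ K i = ws ! champ K i @ x" "ws' ! i = ws ! i @ y"
      using app[of i] app[of "champ K i"] champ_less[OF i(1), of K] i j(4) by auto
    thus "won K (ws' ! champ K i) (ws' ! i)" using j(7) i won_append by auto
  qed
  have nil': "\<forall>i. j < i \<and> i < N \<longrightarrow> ws' ! i = []"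
    using j(8) q c by (auto simp: ws'_def)
  show ?thesis
  proof (cases r)
    case Nil
    have "ws' ! champ K j = v @ [b]" "ws' ! j = v"
      using q Nil c j by (auto simp: ws'_def)
    thus ?thesis unfolding ws'_def[symmetric] using Nil j len won' nil' by auto
  next
    case (Cons x r')
    have e: "ws' ! champ K j = v @ x # r'" "ws' ! j = v @ [b]"
      using q Cons c j by (auto simp: ws'_def)
    show ?thesis
    proof (cases "b = x")
      case True
      thus ?thesis unfolding ws'_def[symmetric] using Cons e j len won' nil' by auto
    next
      case False
      have le: "\<forall>i. 1 \<le> i \<and> i \<le> j \<longrightarrow> won K (ws' ! champ K i) (ws' ! i)"
        if "won K (ws' ! champ K j) (ws' ! j)"
        using won' that by (auto simp: le_less)
      have "matches K N ws' (differ K b n v r' k)"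
      proof (cases "b \<longleftrightarrow> K = Sorted")
        case True
        hence w: "won K (ws' ! champ K j) (ws' ! j)"
          using False e belowI[of v r' "[]"] belowI[of v "[]" r'] by (cases K) auto
        have "matches K N ws' (pass N (ws' ! champ K (Suc j)) k)"
          by (rule matches_pass[OF len j(3,4) le[OF w] nil' refl])
        thus ?thesis using True False e j(2) by (cases K) auto
      next
        case bad: False
        hence "won K (ws' ! j) (ws' ! champ K j)"
          using False e belowI[of v r' "[]"] belowI[of v "[]" r'] by (cases K) auto
        thus ?thesis using bad len j(3,4) by (cases K) (auto intro!: exI[of _ j])
      qed
      thus ?thesis unfolding ws'_def[symmetric] using Cons False by simp
    qed
  qed
qed

section \<open>Decided tests and needed digits\<close>

text \<open>
  Compatible vectors have pairwise different entries; as cylinders are infinite, the entries can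
  be chosen one after the other.
\<close>

lemma distinct_choice:
  assumes "\<And>l. l < n \<Longrightarrow> infinite (A l)"
  shows "\<exists>u. length u = n \<and> distinct u \<and> (\<forall>l<n. u ! l \<in> A l)"
  using assms
proof (induction n)
  case (Suc n)
  then obtain u where u: "length u = n" "distinct u" "\<forall>l<n. u ! l \<in> A l" by auto
  obtain x where "x \<in> A n - set u"
    using Suc.prems[of n] by (metis Diff_infinite_finite finite_set infinite_imp_nonempty
        all_not_in_conv lessI)
  thus ?case using u by (intro exI[of _ "u @ [x]"]) (auto simp: nth_append less_Suc_eq)
qed simp

lemma compatible_nonempty: "compatible ws \<noteq> {}"
  using distinct_choice[of "length ws" "\<lambda>l. cylinder (ws ! l)"] infinite_cylinder
  by (auto simp: compatible_def)

lemma compatibleD: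
  assumes "u \<in> compatible ws"
  shows "length u = length ws" "distinct u" "i < length ws \<Longrightarrow> u ! i \<in> cylinder (ws ! i)"
  using assms by (auto simp: compatible_def)

lemma decided_verdict:
  assumes "\<And>u. u \<in> compatible ws \<Longrightarrow> order_type u \<in> P \<longleftrightarrow> b"
  shows "decided P ws" "verdict P ws \<longleftrightarrow> b"
  using assms compatible_nonempty[of ws] by (auto simp: decided_def verdict_def)

lemma compatible_won:
  assumes "u \<in> compatible ws" "won K (ws ! i) (ws ! j)" "i < length ws" "j < length ws"
  shows "passes K (u ! i) (u ! j)"
  using assms compatibleD[OF assms(1)] by (intro won_passes) auto

lemma matches_Ret:
  assumes "matches K N ws (Ret n)"
  shows "n = N" "decided (perms K) ws" "verdict (perms K) ws"
proof -
  have "order_type u \<in> perms K \<longleftrightarrow> True" if "u \<in> compatible ws" for u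
    unfolding order_type_perms[OF compatibleD(2)[OF that]]
    using assms compatibleD(1)[OF that]
    by (auto intro!: compatible_won[OF that] champ_less_length)
  from decided_verdict[OF this] show "decided (perms K) ws" "verdict (perms K) ws" by auto
qed (use assms in auto)

lemma matches_Geo:
  assumes "matches K N ws (Geo n)"
  shows "n = 0" "decided (perms K) ws" "\<not> verdict (perms K) ws"
proof -
  have "order_type u \<in> perms K \<longleftrightarrow> False" if u: "u \<in> compatible ws" for u
  proof (cases "N = 0")
    case True
    thus ?thesis unfolding order_type_perms[OF compatibleD(2)[OF u]]
      using assms compatibleD(1)[OF u] by auto
  next
    case False
    then obtain i where i: "1 \<le> i" "i < N" "won K (ws ! i) (ws ! champ K i)" using assms by auto
    have "passes K (u ! i) (u ! champ K i)"
      using i assms by (intro compatible_won[OF u] champ_less_length) auto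
    thus ?thesis unfolding order_type_perms[OF compatibleD(2)[OF u]]
      using passes_asym i assms compatibleD(1)[OF u] by auto
  qed
  from decided_verdict[OF this] show "decided (perms K) ws" "\<not> verdict (perms K) ws" by auto
qed (use assms in auto)

text \<open>
  Two compatible vectors are needed that differ only in the coordinate \<open>q\<close> that is asked for and
  on which the test has different outcomes. One of the two numbers in the current comparison is
  \<open>q\<close>; call the other one \<open>q'\<close>. Inside the interval of the champion, \<open>q'\<close> is fixed in the middle
  and \<open>q\<close> is placed once to the left and once to the right of it. This is possible for either
  role of \<open>q\<close>, since the interval of the newcomer contains that of the champion. The numbers
  after the current newcomer are unconstrained and are placed so that their own comparisons
  succeed, whatever happens to \<open>q\<close>.
\<close>

lemma matches_Cmp_needed:
  assumes "matches K N ws (Cmp n v r k)"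
  shows "needed (perms K) ws (query K ws)"
proof -
  obtain j where j: "length ws = N" "1 \<le> j" "j + k + 1 = N" "ws ! champ K j = v @ r"
      "ws ! j = v" "\<forall>i. 1 \<le> i \<and> i < j \<longrightarrow> won K (ws ! champ K i) (ws ! i)"
      "\<forall>i. j < i \<and> i < N \<longrightarrow> ws ! i = []"
    using assms by auto
  define c where "c = champ K j"
  have c: "c < j" unfolding c_def using j(2) by (rule champ_less)
  define q where "q = query K ws"
  have q: "q = (if r = [] then c else j)"
    unfolding q_def c_def by (rule query_eq) (use j in auto)
  define q' where "q' = (if r = [] then j else c)"
  have qq': "{q, q'} = {c, j}" "q \<noteq> q'" "q \<le> j" "q' \<le> j" "q < N" "q' < N"
    using q c j(3) by (auto simp: q'_def)
  define h :: real where "h = 1 / 2 ^ length (v @ r)"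
  have h: "h > 0" by (simp add: h_def)
  \<comment> \<open>The champion's interval is cut at its fifths, which keeps a distance from 0 and from
    1.\<close>
  define p where "p = (\<lambda>i. lower (v @ r) + h * i)"
  have p: "0 < p (1/5)" "p (1/5) < p (2/5)" "p (2/5) < p (3/5)" "p (3/5) < p (4/5)" "p (4/5) < 1"
    using h lower_bounds[of "v @ r"] unfolding h_def[symmetric] by (auto simp: p_def)
  have "{p (1/5)<..<p (4/5)} \<subseteq> cylinder (v @ r)"
    using h unfolding cylinder_eq h_def[symmetric] by (auto simp: p_def)
  hence p_cyl: "{p (1/5)<..<p (4/5)} \<subseteq> cylinder (ws ! l)" if "l \<in> {c, j}" for l
    using that j(4,5) cylinder_append[of v r] by (auto simp: c_def)
  \<comment> \<open>An increasing sequence above \<open>p (4/5)\<close> and below 1. For \<open>Sorted\<close> the number \<open>l\<close>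
    after the newcomer is put between \<open>z l\<close> and \<open>z (l + 1)\<close>; for \<open>MaxFirst\<close> it is put
    below \<open>p (1/5)\<close>.\<close>
  define z where "z = (\<lambda>l::nat. 1 - (1 - p (4/5)) / 2 ^ l)"
  have z: "p (4/5) \<le> z l" "z l < z (Suc l)" "z l < 1" for l
  proof -
    have "(1 - p (4/5)) / 2 ^ l \<le> (1 - p (4/5)) / 1" using p by (intro divide_left_mono) auto
    thus "p (4/5) \<le> z l" by (simp add: z_def)
    show "z l < z (Suc l)" "z l < 1" using p(5) by (auto simp: z_def field_simps)
  qed
  define A where "A = (\<lambda>l.
      if l = q then {p (1/5)<..<p (2/5)} else if l = q' then {p (2/5)<..<p (3/5)}
      else if l < j then cylinder (ws ! l)
      else (case K of Sorted \<Rightarrow> {z l<..<z (Suc l)} | MaxFirst \<Rightarrow> {0<..<p (1/5)}))"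
  have "infinite (A l)" for l
    using p z by (cases K) (auto simp: A_def infinite_cylinder)
  then obtain u where u: "length u = N" "distinct u" "\<forall>l<N. u ! l \<in> A l"
    using distinct_choice[of N A] by blast
  have "infinite ({p (3/5)<..<p (4/5)} - set u)" using p(4) by (intro Diff_infinite_finite) auto
  then obtain y where y: "p (3/5) < y" "y < p (4/5)" "y \<notin> set u"
    by (metis Diff_iff all_not_in_conv finite.emptyI greaterThanLessThan_iff)
  define w where "w = u[q := y]"
  \<comment> \<open>Only the current comparison remains open for such a vector.\<close>
  have outcome: "t \<in> compatible ws \<and> (order_type t \<in> perms K \<longleftrightarrow> passes K (t ! c) (t ! j))"
    if t: "length t = N" "distinct t" "\<forall>l<N. l \<noteq> q \<longrightarrow> t ! l \<in> A l"
       "t ! q \<in> {p (1/5)<..<p (4/5)}" for t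
  proof -
    have t': "t ! l \<in> {p (1/5)<..<p (4/5)}" if "l \<in> {c, j}" for l
    proof (cases "l = q")
      case False
      hence "l = q'" using that qq' by auto
      hence "t ! l \<in> A q'" using t(3) qq' by auto
      thus ?thesis using qq'(2) p by (auto simp: A_def)
    qed (use t(4) in simp)
    have tail: "t ! l \<in> (case K of Sorted \<Rightarrow> {z l<..<z (Suc l)} | MaxFirst \<Rightarrow> {0<..<p (1/5)})"
      if "j < l" "l < N" for l
      using t(3) that qq' by (auto simp: A_def)
    have comp: "t \<in> compatible ws"
      unfolding compatible_def
    proof (intro CollectI conjI allI impI)
      fix l assume l: "l < length ws"
      consider "l \<in> {c, j}" | "l < j" "l \<notin> {c, j}" | "j < l" by force
      thus "t ! l \<in> cylinder (ws ! l)"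
      proof cases
        case 1
        thus ?thesis using t' p_cyl by blast
      next
        case 2
        hence "t ! l \<in> A l" "l \<noteq> q" "l \<noteq> q'" using t(3) l j(1) qq' by auto
        thus ?thesis using 2 by (simp add: A_def)
      next
        case 3
        have "t ! l \<in> {0..<1}"
          using tail[OF 3] l j(1) z[of l] z(3)[of "Suc l"] p by (auto split: kind.splits)
        thus ?thesis using j(7) 3 l j(1) by (simp add: cylinder_eq)
      qed
    qed (use t j in auto)
    have before: "passes K (t ! champ K i) (t ! i)" if "1 \<le> i" "i < j" for i
      using that j champ_less_length[of i N K] by (intro compatible_won[OF comp]) auto
    have after: "passes K (t ! champ K i) (t ! i)" if i: "j < i" "i < N" for i
    proof (cases K)
      case Sorted
      have "t ! (i - 1) < z i"
      proof (cases "i - 1 = j")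
        case True
        thus ?thesis using t'[of j] z(1)[of i] by auto
      next
        case False
        have "i - 1 < N" "j < i - 1" "Suc (i - 1) = i" using False i by auto
        thus ?thesis using tail[of "i - 1"] Sorted by auto
      qed
      thus ?thesis using tail[OF i] Sorted by auto
    next
      case MaxFirst
      hence "c = 0" by (simp add: c_def)
      thus ?thesis using tail[OF i] t'[of c] MaxFirst by auto
    qed
    have "order_type t \<in> perms K \<longleftrightarrow> (\<forall>i. 1 \<le> i \<and> i < N \<longrightarrow> passes K (t ! champ K i) (t ! i))"
      using order_type_perms[OF t(2), of K] t(1) j(3) by auto
    also have "\<dots> \<longleftrightarrow> passes K (t ! c) (t ! j)"
      using before after j(2,3) by (auto simp: c_def) (metis linorder_neqE_nat)
    finally show ?thesis using comp by simp
  qed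
  have u_q: "u ! q \<in> {p (1/5)<..<p (2/5)}" "u ! q' \<in> {p (2/5)<..<p (3/5)}"
    using u(3) qq' by (auto simp: A_def)
  have w: "length w = N" "distinct w" "w ! q = y" "\<And>l. l \<noteq> q \<Longrightarrow> w ! l = u ! l"
    using u y(3) qq'(5) by (auto simp: w_def intro!: distinct_list_update)
  have "u \<in> compatible ws \<and> (order_type u \<in> perms K \<longleftrightarrow> passes K (u ! c) (u ! j))"
    by (rule outcome) (use u u_q p in auto)
  moreover have "w \<in> compatible ws \<and> (order_type w \<in> perms K \<longleftrightarrow> passes K (w ! c) (w ! j))"
    by (rule outcome) (use w u y p in auto)
  moreover have "passes K (u ! c) (u ! j) \<longleftrightarrow> \<not> passes K (w ! c) (w ! j)"
    using w(3) w(4)[of q'] u_q y qq'(2) q by (cases K; cases "r = []") (auto simp: q'_def)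
  moreover have "\<forall>i<length ws. i \<noteq> q \<longrightarrow> u ! i = w ! i" "\<forall>i<length ws. i \<noteq> q \<longrightarrow> w ! i = u ! i"
    using w(4) by auto
  ultimately show ?thesis unfolding needed_def q_def[symmetric] by blast
qed

lemma needed_not_decided: "needed P ws j \<Longrightarrow> \<not> decided P ws"
  unfolding needed_def decided_def by blast

lemma matches_undecided:
  assumes "matches K N ws s" "\<not> decided (perms K) ws"
  obtains n v r k where "s = Cmp n v r k"
  using assms matches_Ret(2) matches_Geo(2) by (cases s) blast+

lemma reachable_matches:
  "reachable (perms K) (query K) N ws \<Longrightarrow> \<exists>s. matches K N ws s"
proof (induction rule: reachable.induct)
  case 1
  show ?case using matches_trial by blast
next
  case (2 ws b)
  thus ?case using matches_undecided matches_nxt by metis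
qed

lemma lazy_query: "lazy_rule (perms K) (query K)"
  unfolding lazy_rule_def
  using reachable_matches matches_undecided matches_Cmp_needed by metis

section \<open>The schema follows the chain\<close>

lemma VN_test_path:
  assumes "VN_test (perms K) (query K) ws fl b" "matches K N ws s"
  shows "path K s fl [] (if b then Ret N else Geo 0)"
  using assms
proof (induction arbitrary: s rule: VN_test.induct)
  case (1 ws)
  show ?case
  proof (cases s)
    case (Geo n)
    thus ?thesis using matches_Geo[of K N ws n] 1 by (auto intro: path_refl)
  next
    case (Cmp n v r k)
    thus ?thesis using matches_Cmp_needed[of K N ws n v r k] needed_not_decided 1 by blast
  next
    case (Ret n)
    thus ?thesis using matches_Ret[of K N ws n] 1 by (auto intro: path_refl)
  qed
next
  case (2 ws b fl v)
  then obtain n w r k where s: "s = Cmp n w r k" using matches_undecided by blast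
  show ?case unfolding s
    by (rule path_flip) (use 2 matches_nxt s in blast)
qed

lemma path_geometric: "path K (Geo m) [] (replicate n True @ [False]) (trial K (m + n))"
proof (induction n arbitrary: m)
  case 0
  show ?case using path_gen[of K m False] path_refl by simp
next
  case (Suc n)
  show ?case using path_gen[of K m True "[]"] Suc[of "Suc m"] by simp
qed

lemma VN_run_path:
  "VN_run (perms K) (query K) fl gl N \<Longrightarrow> path K (Geo 0) fl gl (Ret N)"
proof (induction rule: VN_run.induct)
  case (1 N fl)
  have "path K (trial K N) fl [] (Ret N)" using VN_test_path[OF 1 matches_trial] by simp
  from path_trans[OF path_geometric[of K 0 N, simplified] this] show ?case by simp
next
  case (2 N fl fl' gl' r)
  have "path K (trial K N) fl [] (Geo 0)" using VN_test_path[OF 2(1) matches_trial] by simp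
  from path_trans[OF path_trans[OF path_geometric[of K 0 N, simplified] this] 2(3)] show ?case by simp
qed

lemma path_Ret: "path K (Ret n) fl gl s \<Longrightarrow> fl = [] \<and> gl = [] \<and> s = Ret n"
  by (erule path.cases) auto

text \<open>
  A path from the start has to be cut into trials. The induction over the path therefore treats
  two kinds of states at once: in the generator the ones counted so far are put back in front of
  the answers to come, and inside a trial the flips split into the rest of this test and, if the
  test fails, the flips of a complete run. The states \<open>Ret\<close> and \<open>Geo 0\<close> also count as the end of
  a test.
\<close>

lemma path_first_trial:
  assumes "path K s fl gl (Ret N)"
  shows "(\<forall>n. s = Geo n \<longrightarrow> VN_run (perms K) (query K) fl (replicate n True @ gl) N) \<and>
    (\<forall>M ws. matches K M ws s \<longrightarrow>
       (VN_test (perms K) (query K) ws fl True \<and> gl = [] \<and> M = N) \<or>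
       (\<exists>fl1 fl2. fl = fl1 @ fl2 \<and> VN_test (perms K) (query K) ws fl1 False \<and>
          VN_run (perms K) (query K) fl2 gl N))"
    (is "?run s fl gl \<and> (\<forall>M ws. _ \<longrightarrow> ?split M ws fl gl)")
  using assms
proof (induction s fl gl "Ret N" rule: path.induct)
  case path_refl
  have "?split M ws [] []" if "matches K M ws (Ret N)" for M ws
    using matches_Ret[OF that] VN_test.intros(1)[of "perms K" ws "query K"] by auto
  thus ?case by blast
next
  case (path_gen n b fl gl)
  have run: "?run (Geo n) fl (b # gl)"
  proof (cases b)
    case True
    thus ?thesis using path_gen.hyps(2) by (auto simp: replicate_append_same[symmetric])
  next
    case False
    hence "?split n (replicate n []) fl gl" using path_gen.hyps(2) matches_trial[of K n] by auto
    thus ?thesis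
    proof
      assume "VN_test (perms K) (query K) (replicate n []) fl True \<and> gl = [] \<and> n = N"
      thus ?thesis using False VN_run.intros(1) by auto
    next
      assume "\<exists>fl1 fl2. fl = fl1 @ fl2 \<and> VN_test (perms K) (query K) (replicate n []) fl1 False \<and>
          VN_run (perms K) (query K) fl2 gl N"
      thus ?thesis using False VN_run.intros(2) by fastforce
    qed
  qed
  have "?split M ws fl (b # gl)" if "matches K M ws (Geo n)" for M ws
  proof -
    have "VN_test (perms K) (query K) ws [] False"
      using matches_Geo[OF that] VN_test.intros(1)[of "perms K" ws "query K"] by simp
    moreover have "VN_run (perms K) (query K) fl (b # gl) N"
      using run matches_Geo(1)[OF that] by simp
    ultimately show ?thesis by force
  qed
  thus ?case using run by blast
next
  case (path_flip n v r k b fl gl)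
  have "?split M ws (b # fl) gl" if m: "matches K M ws (Cmp n v r k)" for M ws
  proof -
    let ?ws = "ws[query K ws := ws ! query K ws @ [b]]"
    have "\<not> decided (perms K) ws" using matches_Cmp_needed[OF m] by (rule needed_not_decided)
    note test = VN_test.intros(2)[OF this]
    have "?split M ?ws fl gl" using path_flip.hyps(2) matches_nxt[OF m] by blast
    thus ?thesis using test by (metis append_Cons)
  qed
  thus ?case by blast
qed

theorem VN_run_iff_path: "VN_run (perms K) (query K) fl gl N \<longleftrightarrow> path K (Geo 0) fl gl (Ret N)"
  using VN_run_path path_first_trial[of K "Geo 0" fl gl N] by auto

theorem implements_VN_prog: "implements_VN (prog K) (perms K)"
  unfolding implements_VN_def
  by (rule exI[of _ "query K"]) (simp add: lazy_query machine_path VN_run_iff_path)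

section \<open>Probabilities of the chain\<close>

abbreviation bits :: "real \<Rightarrow> bool stream measure" where
  "bits p \<equiv> stream_space (measure_pmf (bernoulli_pmf p))"

lemma prob_space_bits: "prob_space (bits p)"
  by (intro prob_space.prob_space_stream_space measure_pmf.prob_space_axioms)

lemma space_bits [simp]: "space (bits p) = UNIV"
  by (simp add: space_stream_space)

lemma space_source [simp]: "space (source lam) = UNIV"
  by (simp add: source_def space_pair_measure)

lemma prob_space_source: "prob_space (source lam)"
  unfolding source_def by (intro prob_space_pair prob_space_bits)

lemma measurable_bits_shd [measurable]: "shd \<in> bits p \<rightarrow>\<^sub>M count_space UNIV"
  using measurable_shd[of "measure_pmf (bernoulli_pmf p)"] by simp

lemma measurable_chain [measurable]: "chain K m s \<in> source lam \<rightarrow>\<^sub>M count_space UNIV"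
proof (induction m arbitrary: s)
  case 0
  have "chain K 0 s = (\<lambda>_. s)" by (auto simp: chain.simps)
  thus ?case by simp
next
  case (Suc m)
  note [measurable] = Suc[unfolded source_def]
  show ?case
  proof (cases s)
    case (Geo n)
    have "chain K (Suc m) s = (\<lambda>\<omega>. if shd (snd \<omega>) then chain K m (nxt K s True) (fst \<omega>, stl (snd \<omega>))
        else chain K m (nxt K s False) (fst \<omega>, stl (snd \<omega>)))"
      by (auto simp: chain.simps Geo fun_eq_iff simp del: nxt.simps)
    also have "\<dots> \<in> bits (1/2) \<Otimes>\<^sub>M bits lam \<rightarrow>\<^sub>M count_space UNIV"
      by measurable
    finally show ?thesis unfolding source_def .
  next
    case (Cmp n v r k)
    have "chain K (Suc m) s = (\<lambda>\<omega>. if shd (fst \<omega>) then chain K m (nxt K s True) (stl (fst \<omega>), snd \<omega>)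
        else chain K m (nxt K s False) (stl (fst \<omega>), snd \<omega>))"
      by (auto simp: chain.simps Cmp fun_eq_iff simp del: nxt.simps)
    also have "\<dots> \<in> bits (1/2) \<Otimes>\<^sub>M bits lam \<rightarrow>\<^sub>M count_space UNIV"
      by measurable
    finally show ?thesis unfolding source_def .
  next
    case (Ret n)
    have "chain K (Suc m) s = (\<lambda>_. s)" by (auto simp: Ret)
    thus ?thesis by simp
  qed
qed

text \<open>
  Conditioning on the first bit.
\<close>

lemma nn_integral_bits:
  assumes "0 \<le> p" "p \<le> 1" and [measurable]: "h \<in> borel_measurable (bits p)"
  shows "(\<integral>\<^sup>+f. h f \<partial>bits p) =
    ennreal p * (\<integral>\<^sup>+f. h (True ## f) \<partial>bits p) + ennreal (1 - p) * (\<integral>\<^sup>+f. h (False ## f) \<partial>bits p)"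
  using assms(1,2)
  by (subst prob_space.nn_integral_stream_space[OF measure_pmf.prob_space_axioms])
     (simp_all add: mult.commute)

lemma ennreal_average:
  assumes "0 \<le> p" "0 \<le> q" "0 \<le> x" "0 \<le> y"
  shows "ennreal p * ennreal x + ennreal q * ennreal y = ennreal (p * x + q * y)"
  using assms by (simp add: ennreal_mult)

locale generator =
  fixes lam :: real
  assumes lam_pos: "0 < lam" and lam_less_1: "lam < 1"
begin

sublocale prob_space "source lam"
  by (rule prob_space_source)

text \<open>
  The probability that the chain started in \<open>s\<close> is in \<open>A\<close> after \<open>m\<close> decisions. Both sources are
  independent and have independent bits, so \<open>pr\<close> obeys the backward equations \<open>pr_Cmp\<close> and
  \<open>pr_Geo\<close>; from there on no measure theory is needed for the analysis of the chain.
\<close>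

definition pr :: "kind \<Rightarrow> nat \<Rightarrow> state \<Rightarrow> state set \<Rightarrow> real" where
  "pr K m s A = prob {\<omega>. chain K m s \<omega> \<in> A}"

lemma events_chain [measurable]: "{\<omega>. chain K m s \<omega> \<in> A} \<in> events"
proof -
  have "chain K m s -` A \<inter> space (source lam) \<in> events" by measurable
  thus ?thesis by (simp add: vimage_def)
qed

lemma pr_nonneg: "0 \<le> pr K m s A"
  by (simp add: pr_def)

lemma pr_0: "pr K 0 s A = of_bool (s \<in> A)"
  using prob_space by (simp add: pr_def chain.simps)

lemma pr_Ret: "pr K m (Ret n) A = of_bool (Ret n \<in> A)"
  using prob_space by (simp add: pr_def)

lemma emeasure_pr: "emeasure (source lam) {\<omega>. chain K m s \<omega> \<in> A} = ennreal (pr K m s A)"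
  by (simp add: pr_def emeasure_eq_measure)

text \<open>
  The flips are integrated outside, so that their first bit can be split off; in the case of
  \<open>Geo\<close> it is the other way round.
\<close>

lemma pr_Cmp:
  assumes "s = Cmp n v r k"
  shows "pr K (Suc m) s A = (pr K m (nxt K s True) A + pr K m (nxt K s False) A) / 2"
proof -
  interpret F: prob_space "bits (1/2)" by (rule prob_space_bits)
  interpret G: prob_space "bits lam" by (rule prob_space_bits)
  define E where "E = (\<lambda>m s. {\<omega>. chain K m s \<omega> \<in> A})"
  have [measurable]: "E m s \<in> sets (bits (1/2) \<Otimes>\<^sub>M bits lam)" for m s
    using events_chain unfolding E_def source_def by blast
  have alt: "emeasure (source lam) (E m s) = (\<integral>\<^sup>+f. emeasure (bits lam) (Pair f -` E m s) \<partial>bits (1/2))"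
    for m s unfolding source_def by (subst G.emeasure_pair_measure_alt) simp_all
  have shift: "Pair (b ## f) -` E (Suc m) s = Pair f -` E m (nxt K s b)" for b f
    by (auto simp: E_def chain.simps assms simp del: nxt.simps)
  have "emeasure (source lam) (E (Suc m) s) =
      ennreal (1/2) * emeasure (source lam) (E m (nxt K s True)) +
      ennreal (1/2) * emeasure (source lam) (E m (nxt K s False))"
    unfolding alt
    by (subst nn_integral_bits) (simp_all add: shift G.measurable_emeasure_Pair)
  also have "\<dots> = ennreal ((pr K m (nxt K s True) A + pr K m (nxt K s False) A) / 2)"
    unfolding E_def emeasure_pr
    by (subst ennreal_average) (simp_all add: pr_nonneg add_divide_distrib)
  finally show ?thesis
    unfolding E_def emeasure_pr by (subst (asm) ennreal_inj) (simp_all add: pr_nonneg)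
qed

lemma pr_Geo:
  assumes "s = Geo n"
  shows "pr K (Suc m) s A = lam * pr K m (nxt K s True) A + (1 - lam) * pr K m (nxt K s False) A"
proof -
  interpret F: prob_space "bits (1/2)" by (rule prob_space_bits)
  interpret G: prob_space "bits lam" by (rule prob_space_bits)
  interpret FG: pair_sigma_finite "bits (1/2)" "bits lam" ..
  define E where "E = (\<lambda>m s. {\<omega>. chain K m s \<omega> \<in> A})"
  have [measurable]: "E m s \<in> sets (bits (1/2) \<Otimes>\<^sub>M bits lam)" for m s
    using events_chain unfolding E_def source_def by blast
  have alt: "emeasure (source lam) (E m s) =
      (\<integral>\<^sup>+g. emeasure (bits (1/2)) ((\<lambda>f. (f, g)) -` E m s) \<partial>bits lam)"
    for m s unfolding source_def by (subst FG.emeasure_pair_measure_alt2) simp_all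
  have shift: "(\<lambda>f. (f, b ## g)) -` E (Suc m) s = (\<lambda>f. (f, g)) -` E m (nxt K s b)" for b g
    by (auto simp: E_def chain.simps assms simp del: nxt.simps)
  have [measurable]: "(\<lambda>g. emeasure (bits (1/2)) ((\<lambda>f. (f, g)) -` E m s)) \<in> borel_measurable (bits lam)"
    for m s by (intro FG.measurable_emeasure_Pair2) simp
  have "emeasure (source lam) (E (Suc m) s) =
      ennreal lam * emeasure (source lam) (E m (nxt K s True)) +
      ennreal (1 - lam) * emeasure (source lam) (E m (nxt K s False))"
    unfolding alt
    by (subst nn_integral_bits) (use lam_pos lam_less_1 in \<open>simp_all add: shift\<close>)
  also have "\<dots> = ennreal (lam * pr K m (nxt K s True) A + (1 - lam) * pr K m (nxt K s False) A)"
    unfolding E_def emeasure_pr using lam_pos lam_less_1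
    by (intro ennreal_average) (simp_all add: pr_nonneg)
  finally show ?thesis
    unfolding E_def emeasure_pr using lam_pos lam_less_1
    by (subst (asm) ennreal_inj) (simp_all add: pr_nonneg)
qed

text \<open>
  A supermartingale argument: as \<open>\<Phi> \<ge> 1\<close>, the probability of still running is at most the mean
  of \<open>\<Phi>\<close> over the states that are still running, and this mean drops at least by a factor \<open>t\<close> in
  each step.
\<close>

lemma alive_bound:
  fixes \<Phi> :: "state \<Rightarrow> real"
  assumes "t > 0" "\<And>s. \<Phi> s \<ge> 1"
    and "\<And>n. t * (lam * \<Phi> (Geo (Suc n)) + (1 - lam) * \<Phi> (trial K n)) \<le> \<Phi> (Geo n)"
    and "\<And>n v r k. t * ((\<Phi> (nxt K (Cmp n v r k) True) + \<Phi> (nxt K (Cmp n v r k) False)) / 2)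
           \<le> \<Phi> (Cmp n v r k)"
  shows "pr K m s (- returned) \<le> \<Phi> s / t ^ m"
proof (induction m arbitrary: s)
  case 0
  have "0 \<le> \<Phi> s" using assms(2)[of s] by linarith
  thus ?case using assms(2)[of s] by (simp add: pr_0)
next
  case (Suc m)
  show ?case
  proof (cases s)
    case (Geo n)
    have "pr K (Suc m) s (- returned) =
        lam * pr K m (Geo (Suc n)) (- returned) + (1 - lam) * pr K m (trial K n) (- returned)"
      using pr_Geo[OF Geo, of K m] by (simp add: Geo)
    also have "\<dots> \<le> lam * (\<Phi> (Geo (Suc n)) / t ^ m) + (1 - lam) * (\<Phi> (trial K n) / t ^ m)"
      using lam_pos lam_less_1 Suc by (intro add_mono mult_left_mono) auto
    also have "\<dots> = t * (lam * \<Phi> (Geo (Suc n)) + (1 - lam) * \<Phi> (trial K n)) / t ^ Suc m"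
      using assms(1) by (simp add: field_simps)
    also have "\<dots> \<le> \<Phi> s / t ^ Suc m"
      unfolding Geo using assms(1,3) by (intro divide_right_mono) auto
    finally show ?thesis .
  next
    case (Cmp n v r k)
    have "pr K (Suc m) s (- returned) =
        (pr K m (nxt K s True) (- returned) + pr K m (nxt K s False) (- returned)) / 2"
      by (rule pr_Cmp[OF Cmp])
    also have "\<dots> \<le> (\<Phi> (nxt K s True) / t ^ m + \<Phi> (nxt K s False) / t ^ m) / 2"
      using Suc by (intro divide_right_mono add_mono) auto
    also have "\<dots> = t * ((\<Phi> (nxt K s True) + \<Phi> (nxt K s False)) / 2) / t ^ Suc m"
      using assms(1) by (simp add: field_simps)
    also have "\<dots> \<le> \<Phi> s / t ^ Suc m"
      unfolding Cmp using assms(1,4) by (intro divide_right_mono) auto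
    finally show ?thesis .
  next
    case (Ret n)
    have "0 \<le> \<Phi> s" using assms(2)[of s] by linarith
    thus ?thesis using Ret assms(1) by (simp add: pr_Ret)
  qed
qed

text \<open>
  Optional stopping at the finite time \<open>m\<close>: the harmonic value \<open>V s\<close> is the mean of \<open>V\<close> after
  \<open>m\<close> steps, to which the returned states contribute the probability of \<open>Ret r\<close> and the others
  at most \<open>M\<close> times their probability.
\<close>

lemma harmonic_bound:
  fixes V :: "state \<Rightarrow> real"
  assumes bound: "\<And>s. \<bar>V s\<bar> \<le> M"
    and ret: "\<And>n. V (Ret n) = of_bool (n = r)"
    and geo: "\<And>n. V (Geo n) = lam * V (Geo (Suc n)) + (1 - lam) * V (trial K n)"
    and cmp: "\<And>n v w k. V (Cmp n v w k) = (V (nxt K (Cmp n v w k) True) + V (nxt K (Cmp n v w k) False)) / 2"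
  shows "\<bar>V s - pr K m s {Ret r}\<bar> \<le> M * pr K m s (- returned)"
proof (induction m arbitrary: s)
  case 0
  show ?case using bound[of s] ret by (cases s) (auto simp: pr_0)
next
  case (Suc m)
  show ?case
  proof (cases s)
    case (Geo n)
    let ?a = "Geo (Suc n)" and ?b = "trial K n"
    have "V s - pr K (Suc m) s {Ret r} =
        lam * (V ?a - pr K m ?a {Ret r}) + (1 - lam) * (V ?b - pr K m ?b {Ret r})"
      using pr_Geo[OF Geo, of K m "{Ret r}"] geo[of n] Geo by (simp add: algebra_simps)
    also have "\<bar>\<dots>\<bar> \<le> lam * \<bar>V ?a - pr K m ?a {Ret r}\<bar> + (1 - lam) * \<bar>V ?b - pr K m ?b {Ret r}\<bar>"
      using lam_pos lam_less_1 by (intro order.trans[OF abs_triangle_ineq]) (simp add: abs_mult)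
    also have "\<dots> \<le> lam * (M * pr K m ?a (- returned)) + (1 - lam) * (M * pr K m ?b (- returned))"
      using lam_pos lam_less_1 Suc by (intro add_mono mult_left_mono) auto
    also have "\<dots> = M * pr K (Suc m) s (- returned)"
      unfolding pr_Geo[OF Geo, of K m "- returned"] by (simp add: Geo algebra_simps)
    finally show ?thesis .
  next
    case (Cmp n v w k)
    let ?a = "nxt K s True" and ?b = "nxt K s False"
    have "V s - pr K (Suc m) s {Ret r} = ((V ?a - pr K m ?a {Ret r}) + (V ?b - pr K m ?b {Ret r})) / 2"
      using pr_Cmp[OF Cmp, of K m "{Ret r}"] cmp[of n v w k] Cmp
        by (simp add: algebra_simps diff_divide_distrib add_divide_distrib del: nxt.simps)
    also have "\<bar>\<dots>\<bar> \<le> (\<bar>V ?a - pr K m ?a {Ret r}\<bar> + \<bar>V ?b - pr K m ?b {Ret r}\<bar>) / 2"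
      by (simp add: abs_triangle_ineq)
    also have "\<dots> \<le> (M * pr K m ?a (- returned) + M * pr K m ?b (- returned)) / 2"
      using Suc by (intro divide_right_mono add_mono) auto
    also have "\<dots> = M * pr K (Suc m) s (- returned)"
      unfolding pr_Cmp[OF Cmp, of K m "- returned"] by (simp add: distrib_left)
    finally show ?thesis .
  next
    case (Ret n)
    thus ?thesis using ret by (simp add: pr_Ret)
  qed
qed

section \<open>Exponential decay\<close>

text \<open>
  At \<open>t = 1\<close> one has \<open>c = \<beta> = 1\<close> and the last expression is \<open>1 - \<lambda> + \<lambda>\<^sup>2 < 1\<close>, so all conditions
  hold for \<open>t\<close> slightly above 1. The expression is the share of the potential that is carried
  over to another trial if all trials with \<open>N \<noteq> 1\<close> fail.
\<close>

lemma rate_exists: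
  obtains t c \<beta> :: real where "1 < t" "t\<^sup>2 < 2" "c = t\<^sup>2 / (2 - t\<^sup>2)" "t * lam * c < 1"
    "\<beta> = t * (1 - lam) / (1 - t * lam * c)" "t * (1 - lam) + t\<^sup>2 * lam\<^sup>2 * \<beta> * c\<^sup>2 < 1"
proof -
  define c where "c = (\<lambda>t::real. t\<^sup>2 / (2 - t\<^sup>2))"
  define \<beta> where "\<beta> = (\<lambda>t. t * (1 - lam) / (1 - t * lam * c t))"
  have c: "(c \<longlongrightarrow> 1) (at_right 1)"
    unfolding c_def by (auto intro!: tendsto_eq_intros)
  have b: "(\<beta> \<longlongrightarrow> 1) (at_right 1)"
    unfolding \<beta>_def using lam_less_1 by (auto intro!: tendsto_eq_intros c)
  have 1: "((\<lambda>t::real. t\<^sup>2) \<longlongrightarrow> 1) (at_right 1)" by (auto intro!: tendsto_eq_intros)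
  have 2: "((\<lambda>t. t * lam * c t) \<longlongrightarrow> lam) (at_right 1)" by (auto intro!: tendsto_eq_intros c)
  have 3: "((\<lambda>t. t * (1 - lam) + t\<^sup>2 * lam\<^sup>2 * \<beta> t * (c t)\<^sup>2) \<longlongrightarrow> 1 - lam + lam\<^sup>2) (at_right 1)"
    by (auto intro!: tendsto_eq_intros c b)
  have "lam\<^sup>2 < lam" using lam_pos lam_less_1 by (simp add: power2_eq_square)
  hence "\<forall>\<^sub>F t in at_right 1. t\<^sup>2 < 2 \<and> t * lam * c t < 1 \<and>
      t * (1 - lam) + t\<^sup>2 * lam\<^sup>2 * \<beta> t * (c t)\<^sup>2 < 1 \<and> 1 < t"
    using lam_less_1
    by (intro eventually_conj order_tendstoD(2)[OF 1] order_tendstoD(2)[OF 2] order_tendstoD(2)[OF 3])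
       (auto simp: eventually_at_right_less)
  then obtain t where "t\<^sup>2 < 2 \<and> t * lam * c t < 1 \<and>
      t * (1 - lam) + t\<^sup>2 * lam\<^sup>2 * \<beta> t * (c t)\<^sup>2 < 1 \<and> 1 < t"
    using eventually_happens'[OF trivial_limit_at_right_real] by blast
  thus ?thesis using that[of t "c t" "\<beta> t"] by (auto simp: c_def \<beta>_def)
qed

text \<open>
  The potential is a pessimistic exponential moment of the number of decisions that are left. It
  has the value \<open>B\<close> at the start of a trial and treats a win in a comparison as if all remaining
  comparisons had to be made and the trial was lost in the end. The only success that it takes
  into account is the one of trials with \<open>N = 1\<close>, which need no flip.
\<close>

lemma alive_exponential:
  obtains t B where "t > 1" "\<And>K m. pr K m (Geo 0) (- returned) \<le> B / t ^ m"
proof -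
  obtain t c \<beta> :: real where t: "1 < t" "t\<^sup>2 < 2" and c: "c = t\<^sup>2 / (2 - t\<^sup>2)"
    and tc: "t * lam * c < 1" and b: "\<beta> = t * (1 - lam) / (1 - t * lam * c)"
    and less: "t * (1 - lam) + t\<^sup>2 * lam\<^sup>2 * \<beta> * c\<^sup>2 < 1"
    by (rule rate_exists)
  \<comment> \<open>With the next digit of the champion known, a comparison multiplies the moment by
    \<open>e\<close>, and by \<open>c\<close> if that digit is still to be drawn: \<open>e = t * (c + 1) / 2\<close>, as a flip
    ends the comparison or renews it, and \<open>c = t * e\<close>.\<close>
  define e where "e = t / (2 - t\<^sup>2)"
  define \<delta> where "\<delta> = 1 - (t * (1 - lam) + t\<^sup>2 * lam\<^sup>2 * \<beta> * c\<^sup>2)"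
  \<comment> \<open>Large enough for the three inequalities on \<open>B\<close> below.\<close>
  define B where "B = 1 + 1 / \<beta> + t\<^sup>2 * lam * (1 - lam) / \<delta>"
  have t_sq: "t \<le> t\<^sup>2" "1 \<le> t\<^sup>2" using t by (auto simp: power2_eq_square mult_ge1_I)
  have ec: "e \<le> c" unfolding c e_def using t t_sq by (intro divide_right_mono) auto
  have c1: "c \<ge> 1" and e1: "e \<ge> 1" using t t_sq by (auto simp: c e_def)
  have te: "t * e = c" by (simp add: c e_def power2_eq_square)
  have tc1: "t * (c + 1) / 2 = e" using t by (simp add: c e_def field_simps)
  have \<beta>: "\<beta> > 0" using t tc lam_less_1 by (simp add: b)
  have \<delta>: "\<delta> > 0" using less by (simp add: \<delta>_def)
  have B: "B \<ge> 1" "\<beta> * B \<ge> 1" "B * \<delta> \<ge> t\<^sup>2 * lam * (1 - lam)"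
  proof -
    have pos: "0 \<le> 1 / \<beta>" "0 \<le> t\<^sup>2 * lam * (1 - lam) / \<delta>"
      using \<beta> \<delta> t lam_pos lam_less_1 by auto
    show "B \<ge> 1" using pos by (simp add: B_def)
    have "\<beta> * (1 / \<beta>) \<le> \<beta> * B" using pos \<beta> by (intro mult_left_mono) (auto simp: B_def)
    thus "\<beta> * B \<ge> 1" using \<beta> by simp
    have "t\<^sup>2 * lam * (1 - lam) / \<delta> * \<delta> \<le> B * \<delta>"
      using pos \<delta> by (intro mult_right_mono) (auto simp: B_def)
    thus "B * \<delta> \<ge> t\<^sup>2 * lam * (1 - lam)" using \<delta> by simp
  qed
  \<comment> \<open>The value that makes the inequality at \<open>Geo 1\<close> an equality, where a 0 ends the run.\<close>
  define \<Phi>1 where "\<Phi>1 = t * (1 - lam + lam * (\<beta> * B * c\<^sup>2))"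
  define \<Phi> where "\<Phi> = (\<lambda>s. case s of
      Geo n \<Rightarrow> if n = 0 then B else if n = 1 then \<Phi>1 else \<beta> * B * c ^ n
    | Cmp n v r k \<Rightarrow> B * c ^ k * (if r = [] then c else e)
    | Ret n \<Rightarrow> 1)"
  have ck: "c ^ k \<ge> 1" for k using c1 by simp
  have Bck: "B * c ^ k \<ge> B" "B * c ^ k \<ge> 1" for k
    using B(1) mult_left_mono[OF ck[of k], of B] by linarith+
  have \<Phi>1: "\<Phi>1 \<ge> 1"
  proof -
    have "1 * 1 \<le> (\<beta> * B) * c\<^sup>2" using B(2) ck[of 2] by (intro mult_mono) auto
    hence "lam * 1 \<le> lam * (\<beta> * B * c\<^sup>2)" using lam_pos by (intro mult_left_mono) auto
    hence "1 * 1 \<le> t * (1 - lam + lam * (\<beta> * B * c\<^sup>2))"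
      using t by (intro mult_mono) auto
    thus ?thesis by (simp add: \<Phi>1_def)
  qed
  have ge1: "\<Phi> s \<ge> 1" for s
  proof (cases s)
    case (Geo n)
    have "1 * 1 \<le> (\<beta> * B) * c ^ n" using B(2) ck[of n] by (intro mult_mono) auto
    thus ?thesis using Geo B \<Phi>1 by (simp add: \<Phi>_def)
  next
    case (Cmp n v r k)
    have "1 * 1 \<le> B * c ^ k * (if r = [] then c else e)"
      using Bck[of k] c1 e1 by (intro mult_mono) auto
    thus ?thesis using Cmp by (simp add: \<Phi>_def)
  qed (simp add: \<Phi>_def)
  have pass: "\<Phi> (pass n w k) \<le> B * c ^ k" for n w k
  proof (cases k)
    case 0
    thus ?thesis using B by (simp add: pass_def \<Phi>_def)
  next
    case (Suc k')
    have "B * c ^ k' * (if w = [] then c else e) \<le> B * c ^ k' * c"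
      using Bck[of k'] ec by (intro mult_left_mono) auto
    thus ?thesis using Suc by (simp add: pass_def \<Phi>_def mult_ac)
  qed
  have differ: "\<Phi> (differ K b n v r k) \<le> B * c ^ k" for K b n v r k
    using pass Bck[of k] by (cases K) (auto simp: \<Phi>_def)
  have geo: "t * (lam * \<Phi> (Geo (Suc n)) + (1 - lam) * \<Phi> (trial K n)) \<le> \<Phi> (Geo n)" for K n
  proof -
    consider "n = 0" | "n = 1" | "n \<ge> 2" by linarith
    thus ?thesis
    proof cases
      case 1
      have "\<Phi> (trial K 0) \<le> B" using B by (simp add: trial_def \<Phi>_def)
      hence "t * (lam * \<Phi>1 + (1 - lam) * \<Phi> (trial K 0)) \<le> t * (lam * \<Phi>1 + (1 - lam) * B)"
        using t lam_less_1 by (intro mult_left_mono add_left_mono) auto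
      also have "\<dots> = t\<^sup>2 * lam * (1 - lam) + B * (1 - \<delta>)"
        by (simp add: \<Phi>1_def \<delta>_def algebra_simps power2_eq_square)
      also have "\<dots> \<le> B" using B(3) by (simp add: algebra_simps)
      finally show ?thesis using 1 by (simp add: \<Phi>_def)
    next
      case 2
      thus ?thesis by (simp add: trial_def pass_def \<Phi>_def \<Phi>1_def numeral_2_eq_2 add.commute)
    next
      case 3
      have "\<Phi> (trial K n) \<le> B * c ^ (n - 1)" using pass 3 by (simp add: trial_def)
      also have "\<dots> \<le> B * c ^ n" using B c1 by (intro mult_left_mono power_increasing) auto
      finally have "t * (lam * \<Phi> (Geo (Suc n)) + (1 - lam) * \<Phi> (trial K n)) \<le>
          t * (lam * \<Phi> (Geo (Suc n)) + (1 - lam) * (B * c ^ n))"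
        using t lam_less_1 by (intro mult_left_mono add_left_mono) auto
      also have "\<dots> = (\<beta> * (t * lam * c) + t * (1 - lam)) * (B * c ^ n)"
        using 3 by (simp add: \<Phi>_def algebra_simps)
      also have "\<beta> * (t * lam * c) + t * (1 - lam) = \<beta>"
        using tc by (simp add: b field_simps)
      finally show ?thesis using 3 by (simp add: \<Phi>_def mult_ac)
    qed
  qed
  have cmp: "t * ((\<Phi> (nxt K (Cmp n v r k) True) + \<Phi> (nxt K (Cmp n v r k) False)) / 2)
      \<le> \<Phi> (Cmp n v r k)" for K n v r k
  proof (cases r)
    case Nil
    thus ?thesis by (simp add: \<Phi>_def te[symmetric] mult_ac)
  next
    case (Cons x r')
    have same: "\<Phi> (Cmp n (v @ [x]) r' k) \<le> B * c ^ k * c"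
      using Bck[of k] ec by (auto simp: \<Phi>_def intro!: mult_left_mono)
    have "\<Phi> (nxt K (Cmp n v r k) True) + \<Phi> (nxt K (Cmp n v r k) False) \<le> B * c ^ k * c + B * c ^ k"
      using same differ[of K "\<not> x" n v r' k] Cons by (cases x) (auto simp: add.commute)
    hence "t * ((\<Phi> (nxt K (Cmp n v r k) True) + \<Phi> (nxt K (Cmp n v r k) False)) / 2)
        \<le> t * ((B * c ^ k * c + B * c ^ k) / 2)"
      using t by (intro mult_left_mono divide_right_mono) auto
    also have "\<dots> = B * c ^ k * (t * (c + 1) / 2)" by (simp add: algebra_simps)
    finally show ?thesis using Cons by (simp add: tc1 \<Phi>_def)
  qed
  have "pr K m (Geo 0) (- returned) \<le> B / t ^ m" for K m
    using alive_bound[of t \<Phi> K m "Geo 0", OF _ ge1 geo cmp] t by (simp add: \<Phi>_def)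
  thus ?thesis using that[of t B] t by blast
qed

lemma alive_tendsto_0: "(\<lambda>m. pr K m (Geo 0) (- returned)) \<longlonglongrightarrow> 0"
proof -
  obtain t B where t: "t > 1" "\<And>K m. pr K m (Geo 0) (- returned) \<le> B / t ^ m"
    using alive_exponential by metis
  have "(\<lambda>m. B * (1 / t) ^ m) \<longlonglongrightarrow> B * 0"
    using t(1) by (intro tendsto_intros LIMSEQ_power_zero) auto
  hence "(\<lambda>m. B / t ^ m) \<longlonglongrightarrow> 0" by (simp add: power_one_over)
  from tendsto_sandwich[OF _ _ tendsto_const this] show ?thesis
    by (auto simp: pr_nonneg t(2))
qed


section \<open>The output\<close>

lemma result_iff: "result (prog K) \<omega> = [r] \<longleftrightarrow> (\<exists>m. chain K m (Geo 0) \<omega> = Ret r)"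
proof
  assume *: "result (prog K) \<omega> = [r]"
  hence "halts (prog K) \<omega>" by (auto simp: result_def split: if_splits)
  then obtain m N where m: "chain K m (Geo 0) \<omega> = Ret N" unfolding halts_chain by blast
  hence "result (prog K) \<omega> = [N]" by (rule chain_Ret_result)
  thus "\<exists>m. chain K m (Geo 0) \<omega> = Ret r" using m * by auto
qed (auto intro: chain_Ret_result)

text \<open>
  The value \<open>[]\<close> is the default for runs that do not halt.
\<close>

lemma result_cases: "result (prog K) \<omega> = [] \<or> (\<exists>r. result (prog K) \<omega> = [r])"
  using halts_chain[of K \<omega>] chain_Ret_result(2)[of K _ \<omega>] by (fastforce simp: result_def)

lemma events_result [measurable]: "{\<omega>. result (prog K) \<omega> = out} \<in> events"
proof -
  have single: "{\<omega>. result (prog K) \<omega> = [r]} \<in> events" for r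
  proof -
    have "{\<omega>. result (prog K) \<omega> = [r]} = (\<Union>m. {\<omega>. chain K m (Geo 0) \<omega> \<in> {Ret r}})"
      by (auto simp: result_iff)
    also have "\<dots> \<in> events" using events_chain by (intro sets.countable_UN) blast
    finally show ?thesis .
  qed
  consider r where "out = [r]" | "out = []" | "out \<noteq> []" "\<forall>r. out \<noteq> [r]" by blast
  thus ?thesis
  proof cases
    case 2
    have "{\<omega>. result (prog K) \<omega> = out} = space (source lam) - (\<Union>r. {\<omega>. result (prog K) \<omega> = [r]})"
      using result_cases[of K] 2 by fastforce
    also have "\<dots> \<in> events" using single by blast
    finally show ?thesis .
  next
    case 3
    hence "{\<omega>. result (prog K) \<omega> = out} = {}" using result_cases by blast
    thus ?thesis by (simp only: sets.empty_sets)
  qed (use single in simp)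
qed

lemma measurable_result: "result (prog K) \<in> source lam \<rightarrow>\<^sub>M count_space UNIV"
  unfolding measurable_count_space_eq2_countable using events_result by (auto simp: vimage_def)

lemma halts_AE: "AE \<omega> in source lam. halts (prog K) \<omega>"
proof -
  have eq: "{\<omega>. halts (prog K) \<omega>} = (\<Union>m. {\<omega>. chain K m (Geo 0) \<omega> \<in> returned})"
    by (auto simp: halts_chain)
  have ev: "{\<omega>. halts (prog K) \<omega>} \<in> events"
    unfolding eq using events_chain by (intro sets.countable_UN) blast
  have "1 - pr K m (Geo 0) (- returned) \<le> prob {\<omega>. halts (prog K) \<omega>}" for m
  proof -
    have "prob {\<omega>. \<not> halts (prog K) \<omega>} \<le> pr K m (Geo 0) (- returned)"
      unfolding pr_def by (intro finite_measure_mono events_chain) (auto simp: halts_chain)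
    moreover have "prob {\<omega>. \<not> halts (prog K) \<omega>} = 1 - prob {\<omega>. halts (prog K) \<omega>}"
      using prob_neg[of "halts (prog K)"] ev by simp
    ultimately show ?thesis by simp
  qed
  moreover have "(\<lambda>m. 1 - pr K m (Geo 0) (- returned)) \<longlonglongrightarrow> 1 - 0"
    by (intro tendsto_intros alive_tendsto_0)
  ultimately have "1 - 0 \<le> prob {\<omega>. halts (prog K) \<omega>}"
    by (intro LIMSEQ_le_const2) auto
  hence "prob {\<omega>. halts (prog K) \<omega>} = 1" using prob_le_1 by (intro antisym) auto
  thus ?thesis using AE_prob_1 by fastforce
qed

text \<open>
  Both the difference between \<open>V\<close> and the probability of having returned \<open>r\<close> by time \<open>m\<close>, and
  the probability of returning \<open>r\<close> later, are bounded by multiples of the probability of still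
  running, which vanishes in the limit.
\<close>

lemma prob_result:
  fixes V :: "state \<Rightarrow> real"
  assumes "\<And>s. \<bar>V s\<bar> \<le> M" "\<And>n. V (Ret n) = of_bool (n = r)"
    and "\<And>n. V (Geo n) = lam * V (Geo (Suc n)) + (1 - lam) * V (trial K n)"
    and "\<And>n v w k. V (Cmp n v w k) = (V (nxt K (Cmp n v w k) True) + V (nxt K (Cmp n v w k) False)) / 2"
  shows "prob {\<omega>. result (prog K) \<omega> = [r]} = V (Geo 0)"
proof -
  let ?p = "prob {\<omega>. result (prog K) \<omega> = [r]}" and ?a = "\<lambda>m. pr K m (Geo 0) (- returned)"
  have "\<bar>?p - V (Geo 0)\<bar> \<le> (M + 1) * ?a m" for m
  proof -
    have "pr K m (Geo 0) {Ret r} \<le> ?p"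
      unfolding pr_def by (intro finite_measure_mono events_result) (auto simp: result_iff)
    moreover have "?p \<le> pr K m (Geo 0) {Ret r} + ?a m"
    proof -
      have "chain K m (Geo 0) \<omega> = Ret r"
        if r: "result (prog K) \<omega> = [r]" and ret: "chain K m (Geo 0) \<omega> \<in> returned" for \<omega>
      proof -
        obtain N where N: "chain K m (Geo 0) \<omega> = Ret N" using ret by blast
        have "result (prog K) \<omega> = [N]" using N by (rule chain_Ret_result)
        thus ?thesis using r N by simp
      qed
      hence "?p \<le> prob ({\<omega>. chain K m (Geo 0) \<omega> \<in> {Ret r}} \<union> {\<omega>. chain K m (Geo 0) \<omega> \<in> - returned})"
        by (intro finite_measure_mono sets.Un events_chain) auto
      also have "\<dots> \<le> pr K m (Geo 0) {Ret r} + ?a m"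
        unfolding pr_def by (intro measure_Un_le events_chain)
      finally show ?thesis .
    qed
    ultimately show ?thesis
      using harmonic_bound[OF assms, of "Geo 0" m] by (simp add: distrib_right abs_le_iff)
  qed
  moreover have "(\<lambda>m. (M + 1) * ?a m) \<longlonglongrightarrow> (M + 1) * 0"
    by (intro tendsto_intros alive_tendsto_0)
  ultimately have "\<bar>?p - V (Geo 0)\<bar> \<le> (M + 1) * 0"
    by (intro LIMSEQ_le_const) auto
  thus ?thesis by simp
qed

lemma simulates_pmf:
  assumes "\<And>r. prob {\<omega>. result (prog K) \<omega> = [r]} = pmf p r"
  shows "simulates (prog K) lam p"
  unfolding simulates_def buffon_machine_def
proof (intro conjI halts_AE measurable_result)
  show "distr (source lam) (count_space UNIV) (result (prog K)) = measure_pmf (map_pmf (\<lambda>r. [r]) p)"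
  proof (rule measure_eqI_countable[of _ UNIV])
    fix out :: "nat list"
    have e: "emeasure (distr (source lam) (count_space UNIV) (result (prog K))) {out} =
        ennreal (prob {\<omega>. result (prog K) \<omega> = out})"
      using measurable_result by (simp add: emeasure_distr vimage_def emeasure_eq_measure)
    show "emeasure (distr (source lam) (count_space UNIV) (result (prog K))) {out} =
        emeasure (measure_pmf (map_pmf (\<lambda>r. [r]) p)) {out}"
    proof (cases "\<exists>r. out = [r]")
      case True
      then obtain r where r: "out = [r]" by blast
      have "pmf (map_pmf (\<lambda>r. [r]) p) [r] = pmf p r"
        by (rule pmf_map_inj') (simp add: inj_on_def)
      thus ?thesis unfolding e by (simp add: emeasure_pmf_single r assms)
    next
      case False
      have "AE \<omega> in source lam. result (prog K) \<omega> \<noteq> out"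
        using halts_AE[of K]
      proof eventually_elim
        case (elim \<omega>)
        thus ?case using False unfolding halts_chain by (auto dest: chain_Ret_result(2))
      qed
      hence "prob {\<omega>. result (prog K) \<omega> = out} = 0"
        using prob_eq_0[of "{\<omega>. result (prog K) \<omega> = out}"] events_result by simp
      moreover have "pmf (map_pmf (\<lambda>r. [r]) p) out = 0"
        using False by (auto simp: pmf_eq_0_set_pmf)
      ultimately show ?thesis unfolding e emeasure_pmf_single by simp
    qed
  qed auto
qed

end

section \<open>The number of flips\<close>

text \<open>
  In \<open>n\<close> steps a program sees at most \<open>n\<close> bits of each source. Hence its state at time \<open>n\<close> is a
  function of two finite words, of which there are countably many; this gives measurability
  without a measurable structure on configurations.
\<close>

lemma run_cong:
  assumes "stake n f = stake n f'" "stake n g = stake n g'"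
  shows "run M (f, g) n = run M (f', g') n \<and> nflips (run M (f, g) n) \<le> n \<and> ngens (run M (f, g) n) \<le> n"
  using assms
proof (induction n)
  case 0
  show ?case by (simp add: run_def init_def)
next
  case (Suc n)
  have *: "stake n f = stake n f'" "stake n g = stake n g'"
    using Suc.prems by (auto simp: stake_Suc simp del: stake.simps)
  define c where "c = run M (f, g) n"
  have IH: "run M (f', g') n = c" "nflips c \<le> n" "ngens c \<le> n" using Suc.IH[OF *]
    by (auto simp: c_def)
  have nth: "f !! i = f' !! i" "g !! i = g' !! i" if "i \<le> n" for i
    using Suc.prems that by (metis le_imp_less_Suc stake_nth)+
  have "step M (f, g) c = step M (f', g') c \<and> nflips (step M (f, g) c) \<le> Suc n \<and> ngens (step M (f, g) c) \<le> Suc n"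
    using IH(2,3) nth[of "nflips c"] nth[of "ngens c"]
    by (cases "M ! pc c") (auto simp: step_def split: list.splits)
  moreover have "run M (f, g) (Suc n) = step M (f, g) c" "run M (f', g') (Suc n) = step M (f', g') c"
    using IH(1) by (simp_all add: run_def c_def)
  ultimately show ?case by metis
qed

lemma measurable_total_flips: "total_flips M \<in> source lam \<rightarrow>\<^sub>M count_space UNIV"
proof -
  define X where "X = (\<lambda>n \<omega>. nflips (run M \<omega> n))"
  \<comment> \<open>The padding by \<open>False\<close> is never read.\<close>
  define F where "F = (\<lambda>n a b. nflips (run M (a @- sconst False, b @- sconst False) n))"
  have X: "X n \<omega> = F n (stake n (fst \<omega>)) (stake n (snd \<omega>))" for n \<omega>
  proof -
    have "run M (fst \<omega>, snd \<omega>) n =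
        run M (stake n (fst \<omega>) @- sconst False, stake n (snd \<omega>) @- sconst False) n"
      by (rule conjunct1[OF run_cong]) (simp_all add: stake_shift)
    thus ?thesis by (simp add: X_def F_def)
  qed
  have stakes: "stake n \<in> bits p \<rightarrow>\<^sub>M count_space UNIV" for n p
  proof -
    have "sets (bits p) = sets (stream_space (count_space UNIV))"
      by (rule sets_stream_space_cong) simp
    thus ?thesis using measurable_stake[of n] measurable_cong_sets by blast
  qed
  note [measurable] = stakes
  have [measurable]: "X n \<in> source lam \<rightarrow>\<^sub>M count_space UNIV" for n
  proof -
    have inner: "(\<lambda>\<omega>. F n a (stake n (snd \<omega>))) \<in> bits (1/2) \<Otimes>\<^sub>M bits lam \<rightarrow>\<^sub>M count_space UNIV" for a
      by measurable
    have "(\<lambda>\<omega>. F n (stake n (fst \<omega>)) (stake n (snd \<omega>))) \<in> bits (1/2) \<Otimes>\<^sub>M bits lam \<rightarrow>\<^sub>M count_space UNIV"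
      by (rule measurable_compose_countable[OF inner]) measurable
    thus ?thesis unfolding source_def using X by (simp cong: measurable_cong)
  qed
  have "{\<omega> \<in> space (source lam). total_flips M \<omega> = x} \<in> sets (source lam)" for x
  proof -
    have "{\<omega> \<in> space (source lam). total_flips M \<omega> = x} =
        {\<omega> \<in> space (source lam). \<forall>y. x \<le> y \<longleftrightarrow> (\<forall>n. enat (X n \<omega>) \<le> y)}"
    proof -
      have le: "(\<forall>n. enat (X n \<omega>) \<le> y) \<longleftrightarrow> total_flips M \<omega> \<le> y" for \<omega> y
        by (simp add: total_flips_def X_def SUP_le_iff)
      show ?thesis unfolding le by (auto intro: antisym)
    qed
    also have "\<dots> \<in> sets (source lam)" by measurable
    finally show ?thesis .
  qed
  thus ?thesis unfolding measurable_count_space_eq2_countable by (auto simp: vimage_def)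
qed

context generator
begin

text \<open>
  Every flip is a decision, so more than \<open>m\<close> flips are possible only if the chain is still
  running after \<open>m\<close> decisions.
\<close>

lemma exponential_tails_flips: "exponential_tails (source lam) (total_flips (prog K))"
proof -
  obtain t B where t: "t > 1" "\<And>K m. pr K m (Geo 0) (- returned) \<le> B / t ^ m"
    using alive_exponential by metis
  have "prob {\<omega> \<in> space (source lam). total_flips (prog K) \<omega> > enat m} \<le> B * (1 / t) ^ m" for m
  proof -
    have "{\<omega> \<in> space (source lam). total_flips (prog K) \<omega> > enat m} \<subseteq>
        {\<omega>. chain K m (Geo 0) \<omega> \<in> - returned}"
      using chain_Ret_result(3)[of K m] by (force simp: not_less[symmetric])
    hence "prob {\<omega> \<in> space (source lam). total_flips (prog K) \<omega> > enat m} \<le> pr K m (Geo 0) (- returned)"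
      unfolding pr_def by (intro finite_measure_mono events_chain)
    also have "\<dots> \<le> B * (1 / t) ^ m" using t(2)[of K m] by (simp add: power_one_over)
    finally show ?thesis .
  qed
  thus ?thesis unfolding exponential_tails_def
    using t(1) measurable_total_flips by (intro conjI exI[of _ B] exI[of _ "1 / t"]) auto
qed

end

section \<open>The success probability of a trial\<close>

text \<open>
  The probability that a champion with value \<open>x\<close> survives \<open>k\<close> further comparisons: the remaining
  numbers lie in \<open>[x,1]\<close> in increasing order, or all in \<open>[0,x]\<close>.
\<close>

fun chance :: "kind \<Rightarrow> nat \<Rightarrow> real \<Rightarrow> real" where
  "chance Sorted k x = (1 - x) ^ k / fact k"
| "chance MaxFirst k x = x ^ k"

text \<open>
  An antiderivative of \<open>chance\<close>; up to sign, for \<open>Sorted\<close> it is again a function \<open>chance\<close>.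
\<close>

fun area :: "kind \<Rightarrow> nat \<Rightarrow> real \<Rightarrow> real" where
  "area Sorted k x = - ((1 - x) ^ Suc k / fact (Suc k))"
| "area MaxFirst k x = x ^ Suc k / real (Suc k)"

lemma area_deriv: "(area K k has_real_derivative chance K k x) (at x)"
proof (cases K)
  case Sorted
  have "((\<lambda>x. - ((1 - x) ^ Suc k / fact (Suc k))) has_real_derivative (1 - x) ^ k / fact k) (at x)"
    by (auto intro!: derivative_eq_intros simp del: power_Suc)
  moreover have "area Sorted k = (\<lambda>x. - ((1 - x) ^ Suc k / fact (Suc k)))" by auto
  ultimately show ?thesis using Sorted by simp
next
  case MaxFirst
  have "((\<lambda>x. x ^ Suc k / real (Suc k)) has_real_derivative x ^ k) (at x)"
    by (auto intro!: derivative_eq_intros simp del: power_Suc)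
  moreover have "area MaxFirst k = (\<lambda>x. x ^ Suc k / real (Suc k))" by auto
  ultimately show ?thesis using MaxFirst by simp
qed

lemma chance_bounds:
  assumes "0 \<le> x" "x \<le> 1" shows "0 \<le> chance K k x" "chance K k x \<le> 1"
proof -
  have "(1 - x) ^ k \<le> 1" using assms by (intro power_le_one) auto
  moreover have "(1::real) \<le> fact k" by simp
  ultimately have "(1 - x) ^ k / fact k \<le> 1 / 1" using assms by (intro frac_le) auto
  thus "0 \<le> chance K k x" "chance K k x \<le> 1" using assms by (cases K; simp add: power_le_one)+
qed

text \<open>
  The champion has the value \<open>x\<close> in \<open>[c,d]\<close> and the newcomer is known to lie in \<open>[c,d]\<close>: the
  integral over the positions of the newcomer of the probability that it passes and that the \<open>k\<close>
  comparisons after it succeed. For \<open>Sorted\<close> the newcomer ranges over \<open>[x,d]\<close> and its own value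
  enters, for \<open>MaxFirst\<close> it ranges over \<open>[c,x]\<close> and the champion remains.
\<close>

fun duel :: "kind \<Rightarrow> nat \<Rightarrow> real \<Rightarrow> real \<Rightarrow> real \<Rightarrow> real" where
  "duel Sorted k c d x = area Sorted k d - area Sorted k x"
| "duel MaxFirst k c d x = (x - c) * chance MaxFirst k x"

fun duel_area :: "kind \<Rightarrow> nat \<Rightarrow> real \<Rightarrow> real \<Rightarrow> real \<Rightarrow> real" where
  "duel_area Sorted k c d x = x * area Sorted k d + area Sorted (Suc k) x"
| "duel_area MaxFirst k c d x = area MaxFirst (Suc k) x - c * area MaxFirst k x"

lemma duel_area_deriv: "(duel_area K k c d has_real_derivative duel K k c d x) (at x)"
proof (cases K)
  case Sorted
  have "((\<lambda>x. x * area Sorted k d + area Sorted (Suc k) x) has_real_derivative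
      area Sorted k d + chance Sorted (Suc k) x) (at x)"
    by (auto intro!: derivative_eq_intros area_deriv simp del: area.simps chance.simps)
  moreover have "duel_area Sorted k c d = (\<lambda>x. x * area Sorted k d + area Sorted (Suc k) x)" by auto
  ultimately show ?thesis using Sorted by simp
next
  case MaxFirst
  have "((\<lambda>x. area MaxFirst (Suc k) x - c * area MaxFirst k x) has_real_derivative
      chance MaxFirst (Suc k) x - c * chance MaxFirst k x) (at x)"
    by (auto intro!: derivative_eq_intros area_deriv simp del: area.simps chance.simps)
  moreover have "duel_area MaxFirst k c d = (\<lambda>x. area MaxFirst (Suc k) x - c * area MaxFirst k x)" by auto
  ultimately show ?thesis using MaxFirst by (simp add: algebra_simps)
qed

text \<open>
  The integrand takes its values in \<open>[0,1]\<close> and is integrated over a part of \<open>[c,d]\<close>.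
\<close>

lemma duel_bounds:
  assumes "0 \<le> c" "c \<le> x" "x < d" "d \<le> 1"
  shows "0 \<le> duel K k c d x" "duel K k c d x \<le> d - c"
proof -
  have scaled: "0 \<le> y * p \<and> y * p \<le> d - c" if "0 \<le> y" "y \<le> d - c" "0 \<le> p" "p \<le> 1" for y p
    using that mult_mono[of y "d - c" p 1] by simp
  have "0 \<le> duel K k c d x \<and> duel K k c d x \<le> d - c"
  proof (cases K)
    case Sorted
    obtain z where z: "x < z" "z < d"
      "area Sorted k d - area Sorted k x = (d - x) * chance Sorted k z"
      using MVT2[OF assms(3), of "area Sorted k" "chance Sorted k"] area_deriv by blast
    have "0 \<le> z" "z \<le> 1" using z(1,2) assms by linarith+
    note chance_bounds[OF this, of Sorted k]
    thus ?thesis using scaled[of "d - x" "chance Sorted k z"] z(3) assms Sorted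
      by (simp del: area.simps chance.simps)
  next
    case MaxFirst
    have "0 \<le> x" "x \<le> 1" using assms by linarith+
    note chance_bounds[OF this, of MaxFirst k]
    thus ?thesis using scaled[of "x - c" "chance MaxFirst k x"] assms MaxFirst
      by (simp del: chance.simps)
  qed
  thus "0 \<le> duel K k c d x" "duel K k c d x \<le> d - c" by auto
qed

text \<open>
  The mean of \<open>chance\<close> over the interval of the champion.
\<close>

definition future :: "kind \<Rightarrow> bool list \<Rightarrow> nat \<Rightarrow> real" where
  "future K w k = (area K k (upper w) - area K k (lower w)) * 2 ^ length w"

text \<open>
  The success probability in the state \<open>Cmp n v r k\<close> with \<open>w = v @ r\<close>: the mean over the
  interval of the champion and over that of the newcomer.
\<close>

definition win :: "kind \<Rightarrow> bool list \<Rightarrow> bool list \<Rightarrow> nat \<Rightarrow> real" where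
  "win K v w k =
     (duel_area K k (lower v) (upper v) (upper w) - duel_area K k (lower v) (upper v) (lower w)) *
     2 ^ length w * 2 ^ length v"

lemma future_0: "future K w 0 = 1"
  by (cases K) (simp_all add: future_def)

lemma future_Suc: "future K w (Suc k) = win K [] w k"
  by (cases K) (simp_all add: future_def win_def)

text \<open>
  By the mean value theorem the mean over the interval of the champion is the value at some
  point of it.
\<close>

lemma win_bounds:
  shows "0 \<le> win K v (v @ r) k" "win K v (v @ r) k \<le> 1"
proof -
  let ?w = "v @ r" and ?c = "lower v" and ?d = "upper v"
  have less: "lower ?w < upper ?w" by simp
  obtain x where x: "lower ?w < x" "x < upper ?w"
    "duel_area K k ?c ?d (upper ?w) - duel_area K k ?c ?d (lower ?w) =
       (upper ?w - lower ?w) * duel K k ?c ?d x"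
    using MVT2[OF less, of "duel_area K k ?c ?d" "duel K k ?c ?d"] duel_area_deriv by blast
  have "win K v ?w k = (upper ?w - lower ?w) * 2 ^ length ?w * (duel K k ?c ?d x * 2 ^ length v)"
    unfolding win_def x(3) by (simp only: mult_ac)
  hence eq: "win K v ?w k = duel K k ?c ?d x * 2 ^ length v" by simp
  have "0 \<le> duel K k ?c ?d x" "duel K k ?c ?d x \<le> ?d - ?c"
    using x lower_bounds[of v] lower_append_bounds[of v r]
    by (intro duel_bounds; linarith)+
  hence "0 * 2 ^ length v \<le> duel K k ?c ?d x * 2 ^ length v"
    "duel K k ?c ?d x * 2 ^ length v \<le> (?d - ?c) * 2 ^ length v"
    by (intro mult_right_mono; simp)+
  thus "0 \<le> win K v ?w k" "win K v ?w k \<le> 1" unfolding eq by simp_all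
qed

text \<open>
  A new digit of the champion halves its interval, and the mean over the interval is the mean of
  the means over the two halves.
\<close>

lemma win_extend: "win K v v k = (win K v (v @ [True]) k + win K v (v @ [False]) k) / 2"
proof -
  have "upper (v @ [False]) = lower (v @ [True])" "upper (v @ [True]) = upper v"
    "lower (v @ [False]) = lower v"
    by (simp_all add: lower_snoc field_simps)
  thus ?thesis by (simp only: win_def length_append) (simp add: field_simps)
qed

text \<open>
  A new digit of the newcomer halves its interval. One half contains the interval of the
  champion, and the comparison goes on there. In the other half the comparison is over; it is
  lost, or the remaining integral is that of \<open>chance\<close> over the interval of the next champion.
\<close>

lemma win_compare:
  assumes "w = v @ x # r"
  shows "win K v w k = (win K (v @ [x]) w k +
    (if x = (K = MaxFirst) then future K (if K = Sorted then v @ [True] else w) k else 0)) / 2"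
proof -
  let ?h = "1 / 2 ^ Suc (length v) :: real"
  have len: "(upper w - lower w) * 2 ^ length w = 1" by simp
  have half: "?h * 2 ^ length v = 1 / 2" by simp
  have eqs: "lower (v @ [True]) = lower v + ?h" "upper (v @ [True]) = upper v"
    "lower (v @ [False]) = lower v" "upper (v @ [False]) = lower v + ?h"
    by (simp_all add: lower_snoc field_simps)
  show ?thesis
  proof (cases K)
    case Sorted
    have D: "duel_area Sorted k c d (upper w) - duel_area Sorted k c d (lower w) =
       (upper w - lower w) * area Sorted k d +
       (area Sorted (Suc k) (upper w) - area Sorted (Suc k) (lower w))" for c d
      by (simp add: algebra_simps del: area.simps)
    define a where "a = upper w - lower w"
    define X where "X = area Sorted (Suc k) (upper w) - area Sorted (Suc k) (lower w)"
    have win: "win Sorted v' w k = (a * area Sorted k (upper v') + X) * 2 ^ length w * 2 ^ length v'"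
      for v'
      unfolding win_def D X_def a_def by (rule refl)
    have a: "a * 2 ^ length w = 1" using len by (simp add: a_def)
    show ?thesis
    proof (cases x)
      case True
      have "win Sorted v w k = win Sorted (v @ [True]) w k / 2"
        unfolding win unfolding eqs(2,4) unfolding eqs(1,3) by simp
      thus ?thesis using Sorted True by simp
    next
      case False
      define P where "P = area Sorted k (upper v)"
      define Q where "Q = area Sorted k (lower v + ?h)"
      have "(a * P + X) * 2 ^ length w * 2 ^ length v =
          (a * Q + X) * 2 ^ length w * 2 ^ length v + (a * 2 ^ length w) * (P - Q) * 2 ^ length v"
        by (simp add: algebra_simps)
      also have "\<dots> = ((a * Q + X) * 2 ^ length w * 2 ^ length (v @ [False]) +
          (P - Q) * 2 ^ length (v @ [True])) / 2"
        unfolding a by (simp add: field_simps)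
      finally have "win Sorted v w k = (win Sorted (v @ [False]) w k + future Sorted (v @ [True]) k) / 2"
        unfolding win future_def P_def Q_def unfolding eqs(2,4) unfolding eqs(1,3) .
      thus ?thesis using Sorted False by simp
    qed
  next
    case MaxFirst
    define X where "X = area MaxFirst (Suc k) (upper w) - area MaxFirst (Suc k) (lower w)"
    define Y where "Y = area MaxFirst k (upper w) - area MaxFirst k (lower w)"
    have win: "win MaxFirst v' w k = (X - lower v' * Y) * 2 ^ length w * 2 ^ length v'" for v'
      unfolding win_def X_def Y_def by (simp add: algebra_simps del: area.simps)
    show ?thesis
    proof (cases x)
      case False
      have "win MaxFirst v w k = win MaxFirst (v @ [False]) w k / 2"
        unfolding win unfolding eqs(2,4) unfolding eqs(1,3) by simp
      thus ?thesis using MaxFirst False by simp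
    next
      case True
      have "(X - lower v * Y) * 2 ^ length w * 2 ^ length v =
          (X - (lower v + ?h) * Y) * 2 ^ length w * 2 ^ length v + (?h * 2 ^ length v) * Y * 2 ^ length w"
        by (simp add: algebra_simps)
      also have "\<dots> = ((X - (lower v + ?h) * Y) * 2 ^ length w * 2 ^ length (v @ [True]) + Y * 2 ^ length w) / 2"
        unfolding half by (simp add: field_simps)
      finally have "win MaxFirst v w k = (win MaxFirst (v @ [True]) w k + future MaxFirst w k) / 2"
        unfolding win future_def Y_def unfolding eqs(2,4) unfolding eqs(1,3) .
      thus ?thesis using MaxFirst True by simp
    qed
  qed
qed

section \<open>Rejection sampling\<close>

text \<open>
  The success probability of a trial with \<open>N = n\<close>. For \<open>MaxFirst\<close> and \<open>n = 0\<close> it is \<open>0\<close>, as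
  \<open>1 / 0 = 0\<close>.
\<close>

fun accept :: "kind \<Rightarrow> nat \<Rightarrow> real" where
  "accept Sorted n = 1 / fact n"
| "accept MaxFirst n = 1 / real n"

lemma accept_bounds: "0 \<le> accept K n" "accept K n \<le> 1"
proof -
  show "0 \<le> accept K n" by (cases K) simp_all
  show "accept K n \<le> 1" by (cases K; cases "n = 0") (simp_all add: divide_le_eq_1)
qed

lemma future_Nil: "n > 0 \<Longrightarrow> future K [] (n - 1) = accept K n"
  by (cases K) (simp_all add: future_def)

context generator
begin

lemma summable_accept: "summable (\<lambda>j. lam ^ j * accept K (n + j))"
proof (rule summable_comparison_test')
  show "summable (\<lambda>j. lam ^ j)" using lam_pos lam_less_1 by (intro summable_geometric) simp
  show "norm (lam ^ j * accept K (n + j)) \<le> lam ^ j" for j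
    using lam_pos accept_bounds[of K "n + j"] by (simp add: abs_mult mult_left_le)
qed

text \<open>
  The probability that the current trial succeeds, when the generator has counted \<open>n\<close> ones.
\<close>

definition yield_from :: "kind \<Rightarrow> nat \<Rightarrow> real" where
  "yield_from K n = (1 - lam) * (\<Sum>j. lam ^ j * accept K (n + j))"

lemma yield_from_Suc: "yield_from K n = (1 - lam) * accept K n + lam * yield_from K (Suc n)"
proof -
  have "(\<Sum>j. lam ^ Suc j * accept K (n + Suc j)) = (\<Sum>j. lam ^ j * accept K (n + j)) - accept K n"
    using suminf_split_head[OF summable_accept[of K n]] by simp
  moreover have "(\<Sum>j. lam ^ Suc j * accept K (n + Suc j)) = lam * (\<Sum>j. lam ^ j * accept K (Suc n + j))"
    using suminf_mult[OF summable_accept[of K "Suc n"], of lam] by (simp add: mult_ac)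
  ultimately have "(\<Sum>j. lam ^ j * accept K (n + j)) = accept K n + lam * (\<Sum>j. lam ^ j * accept K (Suc n + j))"
    by linarith
  thus ?thesis unfolding yield_from_def by (simp only: distrib_left mult.assoc mult.left_commute)
qed

lemma yield_from_bounds: "0 \<le> yield_from K n" "yield_from K n \<le> 1"
proof -
  have "0 \<le> (\<Sum>j. lam ^ j * accept K (n + j))"
    using lam_pos accept_bounds by (intro suminf_nonneg summable_accept) auto
  thus "0 \<le> yield_from K n" using lam_less_1 by (simp add: yield_from_def)
  have "(\<Sum>j. lam ^ j * accept K (n + j)) \<le> (\<Sum>j. lam ^ j)"
    using lam_pos lam_less_1 accept_bounds
    by (intro suminf_le summable_accept summable_geometric) (auto intro: mult_left_le)
  also have "\<dots> = 1 / (1 - lam)" using lam_pos lam_less_1 by (intro suminf_geometric) simp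
  finally show "yield_from K n \<le> 1" using lam_less_1 by (simp add: yield_from_def field_simps)
qed

text \<open>
  The harmonic function is the probability of the output \<open>r\<close>: the current trial succeeds with
  \<open>N = r\<close>, or it fails and then everything starts again, with probability \<open>\<pi>\<close> for \<open>r\<close>. The
  hypothesis on \<open>\<pi>\<close> says that this is consistent in the initial state.
\<close>

theorem prob_result_rejection:
  assumes \<pi>: "\<pi> * yield_from K 0 = (1 - lam) * lam ^ r * accept K r" "0 \<le> \<pi>" "\<pi> \<le> 1"
  shows "prob {\<omega>. result (prog K) \<omega> = [r]} = \<pi>"
proof -
  \<comment> \<open>The probability of the output \<open>r\<close> in a trial with \<open>N = n\<close> that succeeds with
    probability \<open>p\<close>.\<close>
  define mix where "mix = (\<lambda>n p. p * of_bool (n = r) + (1 - p) * \<pi>)"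
  define V where "V = (\<lambda>s. case s of
      Geo n \<Rightarrow> (if n \<le> r then (1 - lam) * lam ^ (r - n) * accept K r else 0) + (1 - yield_from K n) * \<pi>
    | Cmp n v w k \<Rightarrow> mix n (win K v (v @ w) k)
    | Ret n \<Rightarrow> of_bool (n = r))"
  have V0: "V (Geo 0) = \<pi>" using \<pi>(1) by (simp add: V_def algebra_simps)
  have pass: "V (pass n w k) = mix n (future K w k)" for n w k
    by (cases k) (simp_all add: pass_def V_def mix_def future_0 future_Suc)
  have trial: "V (trial K n) = mix n (accept K n)" for n
  proof (cases "n = 0")
    case True
    thus ?thesis using V0 by (cases K) (simp_all add: trial_def, simp_all add: V_def mix_def)
  qed (use future_Nil[of n K] in \<open>simp add: trial_def pass\<close>)
  have mix_bound: "\<bar>mix n p\<bar> \<le> 1" if "0 \<le> p" "p \<le> 1" for n p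
  proof -
    have "0 \<le> mix n p" using that \<pi> by (simp add: mix_def)
    moreover have "mix n p \<le> p * 1 + (1 - p) * 1"
      unfolding mix_def using that \<pi> by (intro add_mono mult_left_mono) auto
    ultimately show ?thesis by simp
  qed
  show ?thesis unfolding V0[symmetric]
  proof (rule prob_result[where M = 2])
    show "\<bar>V s\<bar> \<le> 2" for s
    proof (cases s)
      case (Geo n)
      have "0 \<le> (1 - lam) * lam ^ (r - n) * accept K r" "(1 - lam) * lam ^ (r - n) * accept K r \<le> 1"
        using lam_pos lam_less_1 accept_bounds[of K r]
        by (auto intro!: mult_le_one mult_nonneg_nonneg power_le_one)
      moreover have "0 \<le> (1 - yield_from K n) * \<pi>" "(1 - yield_from K n) * \<pi> \<le> 1"
        using yield_from_bounds[of K n] \<pi> by (auto intro!: mult_le_one mult_nonneg_nonneg)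
      ultimately show ?thesis using Geo by (simp add: V_def)
    next
      case (Cmp n v w k)
      thus ?thesis using mix_bound[OF win_bounds, of n K v w k] by (simp add: V_def)
    qed (simp add: V_def)
    show "V (Ret n) = of_bool (n = r)" for n by (simp add: V_def)
    show "V (Geo n) = lam * V (Geo (Suc n)) + (1 - lam) * V (trial K n)" for n
    proof -
      have "(if n \<le> r then (1 - lam) * lam ^ (r - n) * accept K r else 0) =
          lam * (if Suc n \<le> r then (1 - lam) * lam ^ (r - Suc n) * accept K r else 0) +
          (1 - lam) * (accept K n * of_bool (n = r))"
        by (cases n r rule: linorder_cases) (auto simp: Suc_diff_Suc simp flip: power_Suc mult.assoc)
      moreover have "(1 - yield_from K n) * \<pi> =
          lam * ((1 - yield_from K (Suc n)) * \<pi>) + (1 - lam) * ((1 - accept K n) * \<pi>)"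
        by (subst yield_from_Suc) (simp add: algebra_simps)
      ultimately show ?thesis unfolding trial by (simp add: V_def mix_def algebra_simps)
    qed
    have linear: "mix n ((p + q) / 2) = (mix n p + mix n q) / 2" "mix n 0 = \<pi>" for n p q
      by (simp_all add: mix_def field_simps)
    show "V (Cmp n v w k) = (V (nxt K (Cmp n v w k) True) + V (nxt K (Cmp n v w k) False)) / 2"
      for n v w k
    proof (cases w)
      case Nil
      have "mix n (win K v v k) = (mix n (win K v (v @ [True]) k) + mix n (win K v (v @ [False]) k)) / 2"
        by (subst win_extend) (rule linear)
      thus ?thesis using Nil by (simp add: V_def)
    next
      case (Cons x w')
      have same: "V (Cmp n (v @ [x]) w' k) = mix n (win K (v @ [x]) (v @ w) k)"
        by (simp add: V_def Cons)
      define F where "F = (if x = (K = MaxFirst) then future K (if K = Sorted then v @ [True] else v @ w) k else 0)"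
      have F: "V (differ K (\<not> x) n v w' k) = mix n F"
        using V0 Cons by (cases K; cases x) (simp_all add: pass linear F_def)
      have "V (Cmp n v w k) = mix n (win K v (v @ w) k)" by (simp add: V_def)
      also have "win K v (v @ w) k = (win K (v @ [x]) (v @ w) k + F) / 2"
        unfolding F_def by (rule win_compare) (simp add: Cons)
      also have "mix n \<dots> = (V (Cmp n (v @ [x]) w' k) + V (differ K (\<not> x) n v w' k)) / 2"
        unfolding same F by (rule linear)
      finally have "V (Cmp n v w k) = (V (Cmp n (v @ [x]) w' k) + V (differ K (\<not> x) n v w' k)) / 2" .
      thus ?thesis using Cons by (cases x) (auto simp: add.commute)
    qed
  qed
qed

text \<open>
  The acceptance probabilities \<open>1 / n!\<close> turn the geometric weights into those of the exponential
  series.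
\<close>

lemma strongly_simulates_poisson: "strongly_simulates VN_sorted lam (poisson_pmf lam)"
proof -
  have yield: "yield_from Sorted 0 = (1 - lam) * exp lam"
    using exp_converges[of lam] by (simp add: yield_from_def sums_iff field_simps)
  have "pmf (poisson_pmf lam) r * yield_from Sorted 0 = (1 - lam) * lam ^ r * accept Sorted r" for r
    unfolding yield using lam_pos by (simp add: exp_minus field_simps)
  hence "prob {\<omega>. result (prog Sorted) \<omega> = [r]} = pmf (poisson_pmf lam) r" for r
    by (intro prob_result_rejection pmf_nonneg pmf_le_1)
  from simulates_pmf[OF this] show ?thesis
    using exponential_tails_flips[of Sorted] by (simp add: strongly_simulates_def prog.simps)
qed

text \<open>
  The acceptance probabilities \<open>1 / n\<close> turn the geometric weights into those of the logarithmic
  series.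
\<close>

lemma strongly_simulates_logarithmic: "strongly_simulates VN_max_first lam (logarithmic_pmf lam)"
proof -
  define L where "L = ln (1 / (1 - lam))"
  have L: "L > 0" unfolding L_def using lam_pos lam_less_1
    by (intro ln_gt_zero) (simp add: field_simps)
  have pmf: "pmf (logarithmic_pmf lam) r = lam ^ r * accept MaxFirst r / L" for r
    using lam_pos lam_less_1 by (simp add: pmf_logarithmic L_def)
  have "(\<lambda>n. - ((- (- lam)) ^ n) / of_nat n) sums ln (1 + (- lam))"
    by (rule ln_series') (use lam_pos lam_less_1 in auto)
  hence "(\<lambda>n. - (- (lam ^ n) / real n)) sums - ln (1 - lam)"
    by (intro sums_minus) simp
  moreover have "- ln (1 - lam) = L" unfolding L_def using lam_less_1 by (simp add: ln_div)
  ultimately have "(\<lambda>n. lam ^ n / real n) sums L" by simp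
  hence yield: "yield_from MaxFirst 0 = (1 - lam) * L"
    by (simp add: yield_from_def sums_iff)
  have "pmf (logarithmic_pmf lam) r * yield_from MaxFirst 0 = (1 - lam) * lam ^ r * accept MaxFirst r"
    for r
    unfolding yield pmf using L by simp
  hence "prob {\<omega>. result (prog MaxFirst) \<omega> = [r]} = pmf (logarithmic_pmf lam) r" for r
    by (intro prob_result_rejection pmf_nonneg pmf_le_1)
  from simulates_pmf[OF this] show ?thesis
    using exponential_tails_flips[of MaxFirst] by (simp add: strongly_simulates_def prog.simps)
qed

end

lemma one_string_register: "card (string_regs (prog K)) = 1"
  by (cases K) (simp_all add: prog.simps string_regs_def VN_sorted_def VN_max_first_def)

theorem theorem2p2:
  fixes lam :: real
  assumes "0 < lam" and "lam < 1"
  shows "(implements_VN VN_sorted sorted_perms \<and>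
          strongly_simulates VN_sorted lam (poisson_pmf lam) \<and>
          card (string_regs VN_sorted) = 1) \<and>
         (implements_VN VN_max_first max_first_perms \<and>
          strongly_simulates VN_max_first lam (logarithmic_pmf lam) \<and>
          card (string_regs VN_max_first) = 1)"
proof -
  interpret generator lam using assms by unfold_locales
  show ?thesis
    using implements_VN_prog[of Sorted] implements_VN_prog[of MaxFirst]
      one_string_register[of Sorted] one_string_register[of MaxFirst]
      strongly_simulates_poisson strongly_simulates_logarithmic
    by (simp add: prog.simps)
qed

end
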